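(* Let $K,m\ge1$, $A=(a_{ij})_{i,j=1,\dots,K}$ a real matrix and $b=(b_1,\dots,b_K)\in\mathbb R^K$, and suppose that $(A,b)$ satisfies the $m$th-order conditions: for every rooted tree $t=[t_1\cdots t_l]\in T_{\le m}$ (including the one-vertex tree $t=\tau$, for which $l=0$ and the product is empty), $$\frac{\alpha(t)}{r(t)!}=\frac{\sum_{i=1}^Kb_i\prod_{k=1}^l\zeta_i(t_k;A)}{\sigma(t)}.$$ For $W\in C_b^\infty(\mathbb R^N;\mathbb R^N)$ and $y_0\in\mathbb R^N$ let $g(W)(y_0)=Y(y_0;W,1)$, where $Y$ is given by the $K$-stage Runge--Kutta method $$Y_i(W,s)=y_0+s\sum_{j=1}^Ka_{ij}W(Y_j(W,s))\ (i=1,\dots,K),\qquad Y(y_0;W,s)=y_0+s\sum_{i=1}^Kb_iW(Y_i(W,s)).$$ Then $g\in\mathcal{IS}(m)$.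
   Context: $C_b^\infty(\mathbb R^N;\mathbb R^N)$: infinitely differentiable maps $\mathbb R^N\to\mathbb R^N$ whose derivatives are all bounded (order zero included). For such $W$, $\exp(W)(x)$ is the time-$1$ value of the solution of $dz_t/dt=W(z_t)$, $z_0=x$; $\|W\|_{C^n}=\sum_{i=0}^n\|W^{(i)}\|$, where $\|W^{(0)}\|=\sup_x|W(x)|$ and $\|W^{(i)}\|=\sup\{|W^{(i)}_{(x)}(U_1,\dots,U_i)|:x\in\mathbb R^N,|U_k|=1\}$, $W^{(i)}$ being the $i$th total differential. $\mathcal{IS}(m)$ is the set of maps $g$ from $C_b^\infty(\mathbb R^N;\mathbb R^N)$ to the set of maps $\mathbb R^N\to\mathbb R^N$ for which there is a constant $C_m>0$ with $\sup_x|g(W)(x)-\exp(W)(x)|\le C_m\|W\|_{C^{m+1}}^{m+1}$ for all $W\in C_b^\infty(\mathbb R^N;\mathbb R^N)$. Trees: a labelled tree is a pair $(V,E)$ with $V\subset\mathbb Z$ finite nonempty and $E\subset\{(x,y)\in V\times V:x<y\}$, such that each $y$ has at most one $x$ with $(x,y)\in E$, and for any two distinct vertices $x,y$ there is a directed path from one to the other, or directed paths from some third vertex to both. It has a unique root, from which there is a path to every other vertex. Two labelled trees are isomorphic if there is a bijection of vertex sets which maps the edge set of one onto the edge set of the other; $T$ is the set of isomorphism classes (non-labelled rooted trees). $\tau$ is the one-vertex tree; $[t_1\cdots t_l]$ is the tree obtained by joining a new root to the roots of $t_1,\dots,t_l$ (the order is irrelevant; every $t\ne\tau$ is of this form), and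 $[t_1^{m_1}\cdots t_n^{m_n}]$ means that $t_i$ occurs $m_i$ times. $r(t)$ is the number of vertices, $T_{\le m}=\{t\in T:r(t)\le m\}$. $\alpha(t)$ is the number of labelled trees that have the same vertex set as a given labelled representative of $t$ and are isomorphic to it. $\sigma(\tau)=1$ and $\sigma([t_1^{m_1}\cdots t_l^{m_l}])=\prod_{i=1}^lm_i!\,\sigma(t_i)^{m_i}$ for distinct $t_1,\dots,t_l$. $\zeta_i(\tau;A)=\sum_{j=1}^Ka_{ij}$ and $\zeta_i([t_1\cdots t_l];A)=\sum_{j=1}^Ka_{ij}\prod_{k=1}^l\zeta_j(t_k;A)$. *)

theory Defs
  imports "HOL-Analysis.Analysis" "HOL-Library.Multiset"
begin

section \<open>Smooth bounded vector fields and their exponentials\<close>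

text \<open>
  \<open>total_diff W [U\<^sub>1, \<dots>, U\<^sub>i] x\<close> is the \<open>i\<close>th total differential of \<open>W\<close> at \<open>x\<close> applied to
  \<open>U\<^sub>1, \<dots>, U\<^sub>i\<close>: the differential of order \<open>i + 1\<close> is the differential of the one of order \<open>i\<close>,
  evaluated with its last \<open>i\<close> arguments held fixed.  It is meaningful when all the functions
  involved are differentiable, as is the case on \<open>Cb_inf\<close>.
\<close>

fun total_diff :: "('a::real_normed_vector \<Rightarrow> 'b::real_normed_vector) \<Rightarrow> 'a list \<Rightarrow> 'a \<Rightarrow> 'b" where
  "total_diff W [] = W"
| "total_diff W (U # Us) = (\<lambda>x. frechet_derivative (total_diff W Us) (at x) U)"

definition unit_args :: "nat \<Rightarrow> 'a::real_normed_vector list set" where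
  "unit_args i = {Us. length Us = i \<and> (\<forall>U\<in>set Us. norm U = 1)}"

definition diff_norms :: "(real ^ 'n \<Rightarrow> real ^ 'n) \<Rightarrow> nat \<Rightarrow> real set" where
  "diff_norms W i = {norm (total_diff W Us x) |Us x. Us \<in> unit_args i}"

definition Cb_inf :: "(real ^ 'n \<Rightarrow> real ^ 'n) set" where
  "Cb_inf = {W. (\<forall>Us x. total_diff W Us differentiable (at x)) \<and> (\<forall>i. bounded (diff_norms W i))}"

definition C_norm :: "nat \<Rightarrow> (real ^ 'n \<Rightarrow> real ^ 'n) \<Rightarrow> real" where
  "C_norm n W = (\<Sum>i = 0..n. Sup (diff_norms W i))"

definition exp_flow :: "(real ^ 'n \<Rightarrow> real ^ 'n) \<Rightarrow> real ^ 'n \<Rightarrow> real ^ 'n" where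
  "exp_flow W x = (THE y. \<exists>z. z 0 = x \<and> z 1 = y \<and>
     (\<forall>t\<in>{0..1}. (z has_vector_derivative W (z t)) (at t within {0..1})))"

text \<open>
  The arguments \<open>W\<close> of the maps \<open>g\<close> range over a type, so the values of \<open>g\<close> outside
  \<open>Cb_inf\<close> are left unconstrained.
\<close>

definition IS :: "nat \<Rightarrow> ((real ^ 'n \<Rightarrow> real ^ 'n) \<Rightarrow> real ^ 'n \<Rightarrow> real ^ 'n) set" where
  "IS m = {g. \<exists>C>0. \<forall>W\<in>Cb_inf. \<forall>x.
     norm (g W x - exp_flow W x) \<le> C * C_norm (m + 1) W ^ (m + 1)}"


section \<open>Labelled and non-labelled rooted trees\<close>

type_synonym lgraph = "int set \<times> (int \<times> int) set"

definition labelled_tree :: "lgraph \<Rightarrow> bool" where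
  "labelled_tree = (\<lambda>(V, E). finite V \<and> V \<noteq> {} \<and> E \<subseteq> {(x, y) \<in> V \<times> V. x < y} \<and>
     (\<forall>x x' y. (x, y) \<in> E \<and> (x', y) \<in> E \<longrightarrow> x = x') \<and>
     (\<forall>x\<in>V. \<forall>y\<in>V. x \<noteq> y \<longrightarrow>
        (x, y) \<in> E\<^sup>+ \<or> (y, x) \<in> E\<^sup>+ \<or>
        (\<exists>z\<in>V. z \<noteq> x \<and> z \<noteq> y \<and> (z, x) \<in> E\<^sup>+ \<and> (z, y) \<in> E\<^sup>+)))"

definition lt_iso :: "lgraph \<Rightarrow> lgraph \<Rightarrow> bool" where
  "lt_iso G H \<longleftrightarrow>
     (\<exists>\<phi>. bij_betw \<phi> (fst G) (fst H) \<and> map_prod \<phi> \<phi> ` snd G = snd H)"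

text \<open>
  Isomorphism classes of rooted trees: \<open>Node M\<close> is \<open>[t\<^sub>1 \<cdots> t\<^sub>l]\<close> where \<open>M\<close> is the multiset
  of the \<open>t\<^sub>k\<close>, and \<open>Node {#}\<close> is the one-vertex tree.  The isomorphism class of a labelled
  tree is identified with such a term through \<open>represents\<close>; see the lemmas
  \<open>represents_ex\<close>, \<open>represents_onto\<close>, \<open>represents_iff_iso\<close> and \<open>represents_card\<close> below.
\<close>

datatype rtree = Node "rtree multiset"

inductive has_shape :: "(int \<times> int) set \<Rightarrow> int \<Rightarrow> rtree \<Rightarrow> bool" for E where
  "(\<And>y. (x, y) \<in> E \<Longrightarrow> has_shape E y (f y)) \<Longrightarrow>
     has_shape E x (Node (image_mset f (mset_set {y. (x, y) \<in> E})))"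

definition is_root :: "lgraph \<Rightarrow> int \<Rightarrow> bool" where
  "is_root G x \<longleftrightarrow> x \<in> fst G \<and> (\<forall>y\<in>fst G - {x}. (x, y) \<in> (snd G)\<^sup>+)"

definition represents :: "lgraph \<Rightarrow> rtree \<Rightarrow> bool" where
  "represents G t \<longleftrightarrow> labelled_tree G \<and> (\<exists>x. is_root G x \<and> has_shape (snd G) x t)"

lemma image_mset_fundef_cong [fundef_cong]:
  "M = N \<Longrightarrow> (\<And>x. x \<in># N \<Longrightarrow> f x = g x) \<Longrightarrow> image_mset f M = image_mset g N"
  by (auto intro: image_mset_cong)

lemma size_in_rtree [termination_simp]:
  "t \<in># M \<Longrightarrow> size t < Suc (size_multiset size M)"
  by (auto dest!: multi_member_split simp: size_multiset_add_mset)

fun tree_order :: "rtree \<Rightarrow> nat" where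
  "tree_order (Node M) = 1 + \<Sum>\<^sub># (image_mset tree_order M)"

text \<open>
  The choice of the labelled representative is immaterial: the number depends on the vertex set
  only through its order type.
\<close>

definition tree_alpha :: "rtree \<Rightarrow> nat" where
  "tree_alpha t = (let G = SOME G. represents G t in
     card {H. labelled_tree H \<and> fst H = fst G \<and> lt_iso H G})"

fun tree_sigma :: "rtree \<Rightarrow> nat" where
  "tree_sigma (Node M) = (\<Prod>t\<in>set_mset M. fact (count M t) * tree_sigma t ^ count M t)"

fun zeta :: "real ^ 'k ^ 'k \<Rightarrow> 'k \<Rightarrow> rtree \<Rightarrow> real" where
  "zeta A i (Node M) = (\<Sum>j\<in>UNIV. A $ i $ j * \<Prod>\<^sub># (image_mset (zeta A j) M))"


section \<open>Runge--Kutta methods\<close>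

definition order_conditions :: "nat \<Rightarrow> real ^ 'k ^ 'k \<Rightarrow> real ^ 'k \<Rightarrow> bool" where
  "order_conditions m A b \<longleftrightarrow> (\<forall>t M. t = Node M \<and> tree_order t \<le> m \<longrightarrow>
     real (tree_alpha t) / fact (tree_order t) =
     (\<Sum>i\<in>UNIV. b $ i * \<Prod>\<^sub># (image_mset (zeta A i) M)) / real (tree_sigma t))"

definition rk_stages ::
    "real ^ 'k ^ 'k \<Rightarrow> (real ^ 'n \<Rightarrow> real ^ 'n) \<Rightarrow> real ^ 'n \<Rightarrow> real \<Rightarrow> ('k \<Rightarrow> real ^ 'n) \<Rightarrow> bool" where
  "rk_stages A W y0 s Y \<longleftrightarrow> (\<forall>i. Y i = y0 + s *\<^sub>R (\<Sum>j\<in>UNIV. A $ i $ j *\<^sub>R W (Y j)))"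

text \<open>
  The method may be implicit.  The stage equations are then solvable (\<open>rk_stages_ex\<close>), but for
  large \<open>s\<close> the solution need not be unique, so the result of a step is a relation.
\<close>

definition rk_step ::
    "real ^ 'k ^ 'k \<Rightarrow> real ^ 'k \<Rightarrow> (real ^ 'n \<Rightarrow> real ^ 'n) \<Rightarrow> real ^ 'n \<Rightarrow> real \<Rightarrow> real ^ 'n \<Rightarrow> bool" where
  "rk_step A b W y0 s y \<longleftrightarrow>
     (\<exists>Y. rk_stages A W y0 s Y \<and> y = y0 + s *\<^sub>R (\<Sum>i\<in>UNIV. b $ i *\<^sub>R W (Y i)))"

section \<open>Solvability of the stage equations\<close>

lemma Cb_inf_continuous: "W \<in> Cb_inf \<Longrightarrow> continuous_on UNIV W"
proof -
  assume "W \<in> Cb_inf"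
  then have "total_diff W [] differentiable (at x)" for x
    unfolding Cb_inf_def by blast
  then show ?thesis
    by (simp add: continuous_on_eq_continuous_within differentiable_imp_continuous_within)
qed

lemma Cb_inf_bounded:
  assumes "W \<in> Cb_inf"
  obtains B where "\<And>x. norm (W x) \<le> B"
proof -
  have "bounded (diff_norms W 0)"
    using assms by (auto simp: Cb_inf_def)
  then obtain B where "\<And>r. r \<in> diff_norms W 0 \<Longrightarrow> norm r \<le> B"
    by (auto simp: bounded_iff)
  moreover have "norm (W x) \<in> diff_norms W 0" for x
    unfolding diff_norms_def unit_args_def by force
  ultimately show thesis using that by fastforce
qed

lemma rk_stages_ex:
  fixes W :: "real ^ 'n \<Rightarrow> real ^ 'n" and A :: "real ^ 'k ^ 'k"
  assumes W: "W \<in> Cb_inf"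
  shows "\<exists>Y. rk_stages A W y0 s Y"
proof -
  obtain B where B: "\<And>x. norm (W x) \<le> B"
    using Cb_inf_bounded[OF W] by blast
  define F :: "(real ^ 'n) ^ 'k \<Rightarrow> (real ^ 'n) ^ 'k" where
    "F Y = (\<chi> i. y0 + s *\<^sub>R (\<Sum>j\<in>UNIV. A $ i $ j *\<^sub>R W (Y $ j)))" for Y
  define R where "R i = norm y0 + \<bar>s\<bar> * (\<Sum>j\<in>UNIV. \<bar>A $ i $ j\<bar> * B)" for i
  have comp: "norm (F Y $ i) \<le> R i" for Y i
  proof -
    have "norm (\<Sum>j\<in>UNIV. A $ i $ j *\<^sub>R W (Y $ j)) \<le> (\<Sum>j\<in>UNIV. \<bar>A $ i $ j\<bar> * B)"
      by (rule order_trans[OF norm_sum]) (auto intro!: sum_mono mult_left_mono B)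
    then show ?thesis
      unfolding F_def R_def
      by (auto intro!: order_trans[OF norm_triangle_ineq] mult_left_mono)
  qed
  have bd: "norm (F Y) \<le> (\<Sum>i\<in>UNIV. R i)" for Y
    unfolding norm_vec_def[of "F Y"]
    by (rule order_trans[OF L2_set_le_sum]) (auto intro!: sum_mono comp)
  have cont: "continuous_on UNIV F"
    unfolding F_def
    by (intro continuous_intros continuous_on_compose2[OF Cb_inf_continuous[OF W]]) auto
  define S where "S = cball (0::(real ^ 'n) ^ 'k) (\<Sum>i\<in>UNIV. R i)"
  have "\<exists>Y\<in>S. F Y = Y"
  proof (rule brouwer[of S F])
    show "compact S" "convex S" by (simp_all add: S_def)
    have "F 0 \<in> S" using bd by (simp add: S_def)
    then show "S \<noteq> {}" by auto
    show "continuous_on S F" using cont continuous_on_subset by blast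
    show "F \<in> S \<rightarrow> S" using bd by (auto simp: S_def)
  qed auto
  then obtain Y where "F Y = Y" by blast
  then have "rk_stages A W y0 s (\<lambda>i. Y $ i)"
    unfolding rk_stages_def F_def by (auto simp: vec_eq_iff)
  then show ?thesis by blast
qed

section \<open>The terms of type rtree are the isomorphism classes of labelled trees\<close>

definition forest_edges :: "(int \<times> int) set \<Rightarrow> bool" where
  "forest_edges E \<longleftrightarrow> finite E \<and> (\<forall>x y. (x, y) \<in> E \<longrightarrow> x < y) \<and>
     (\<forall>x x' y. (x, y) \<in> E \<longrightarrow> (x', y) \<in> E \<longrightarrow> x = x')"

abbreviation children :: "(int \<times> int) set \<Rightarrow> int \<Rightarrow> int set" where
  "children E x \<equiv> {y. (x, y) \<in> E}"

abbreviation desc :: "(int \<times> int) set \<Rightarrow> int \<Rightarrow> int set" where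
  "desc E x \<equiv> E\<^sup>* `` {x}"

lemma finite_children: "forest_edges E \<Longrightarrow> finite (children E x)"
  by (rule finite_subset[of _ "snd ` E"]) (force simp: forest_edges_def)+

lemma forest_rtrancl_le: "forest_edges E \<Longrightarrow> (x, y) \<in> E\<^sup>* \<Longrightarrow> x \<le> y"
  by (rotate_tac, induction rule: rtrancl_induct) (force simp: forest_edges_def)+

lemma forest_trancl_less: "forest_edges E \<Longrightarrow> (x, y) \<in> E\<^sup>+ \<Longrightarrow> x < y"
  by (rotate_tac, induction rule: trancl_induct) (force simp: forest_edges_def)+

lemma desc_unfold: "desc E x = insert x (\<Union>c\<in>children E x. desc E c)"
  by (auto elim: converse_rtranclE intro: converse_rtrancl_into_rtrancl)

lemma forest_disjoint:
  assumes F: "forest_edges E" and c: "(x, c) \<in> E" "(x, d) \<in> E"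
    and u: "(c, u) \<in> E\<^sup>*" "(d, u) \<in> E\<^sup>*"
  shows "c = d"
proof -
  have *: "a = b" if ab: "(a, b) \<in> E\<^sup>*" "(x, a) \<in> E" "(x, b) \<in> E" for a b
    using ab(1)
  proof (cases rule: rtranclE)
    case (step y)
    then have "y = x" using F ab by (auto simp: forest_edges_def)
    then have "a \<le> x" using step forest_rtrancl_le[OF F] by blast
    then show ?thesis using F ab by (force simp: forest_edges_def)
  qed auto
  have "single_valued (E\<inverse>)"
    using F by (auto simp: forest_edges_def single_valued_def)
  moreover have "(u, c) \<in> (E\<inverse>)\<^sup>*" "(u, d) \<in> (E\<inverse>)\<^sup>*"
    using u by (auto simp: rtrancl_converse)
  ultimately have "(c, d) \<in> (E\<inverse>)\<^sup>* \<or> (d, c) \<in> (E\<inverse>)\<^sup>*"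
    by (rule single_valued_confluent)
  then show ?thesis using *[of c d] *[of d c] c by (auto simp: rtrancl_converse)
qed

lemma labelled_tree_forest:
  assumes "labelled_tree G"
  shows "forest_edges (snd G)"
proof -
  have sub: "snd G \<subseteq> {(x, y) \<in> fst G \<times> fst G. x < y}" and fin: "finite (fst G)"
    and un: "\<forall>x x' y. (x, y) \<in> snd G \<and> (x', y) \<in> snd G \<longrightarrow> x = x'"
    using assms by (auto simp: labelled_tree_def split: prod.splits)
  have "snd G \<subseteq> fst G \<times> fst G" using sub by blast
  then have "finite (snd G)" by (rule finite_subset) (use fin in simp)
  then show ?thesis using sub un unfolding forest_edges_def by blast
qed

lemma labelled_tree_edges: "labelled_tree G \<Longrightarrow> (x, y) \<in> snd G \<Longrightarrow> x \<in> fst G \<and> y \<in> fst G"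
  by (auto simp: labelled_tree_def)

lemma labelled_tree_root:
  assumes "labelled_tree G"
  shows "is_root G (Min (fst G))"
proof -
  have fin: "finite (fst G)" "fst G \<noteq> {}"
    using assms by (auto simp: labelled_tree_def)
  let ?x = "Min (fst G)"
  have x: "?x \<in> fst G" "\<And>y. y \<in> fst G \<Longrightarrow> ?x \<le> y" using fin by auto
  have less: "a < b" if "(a, b) \<in> (snd G)\<^sup>+" for a b
    using that forest_trancl_less labelled_tree_forest[OF assms] by blast
  have "(?x, y) \<in> (snd G)\<^sup>+" if y: "y \<in> fst G - {?x}" for y
  proof -
    have "(?x, y) \<in> (snd G)\<^sup>+ \<or> (y, ?x) \<in> (snd G)\<^sup>+ \<or> (\<exists>z\<in>fst G. (z, ?x) \<in> (snd G)\<^sup>+)"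
      using assms y x(1) unfolding labelled_tree_def case_prod_beta by blast
    then show ?thesis using less x(2) y by (meson DiffD1 leD)
  qed
  then show ?thesis using x by (auto simp: is_root_def)
qed

lemma labelled_tree_root_unique:
  assumes "labelled_tree G" "is_root G x"
  shows "x = Min (fst G)"
proof (rule ccontr)
  assume ne: "x \<noteq> Min (fst G)"
  have "is_root G (Min (fst G))" by (rule labelled_tree_root[OF assms(1)])
  with ne assms(2) have cyc: "(x, Min (fst G)) \<in> (snd G)\<^sup>+" "(Min (fst G), x) \<in> (snd G)\<^sup>+"
    by (auto simp: is_root_def)
  from cyc show False
    using forest_trancl_less[OF labelled_tree_forest[OF assms(1)]] by (meson order_less_asym)
qed

lemma labelled_tree_desc:
  assumes "labelled_tree G" "is_root G x"
  shows "desc (snd G) x = fst G"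
proof
  show "desc (snd G) x \<subseteq> fst G"
    using assms by (auto simp: is_root_def labelled_tree_edges elim: rtranclE)
  show "fst G \<subseteq> desc (snd G) x"
    using assms by (auto simp: is_root_def dest: trancl_into_rtrancl)
qed

lemma labelled_treeI:
  assumes "finite V" "x \<in> V" "E \<subseteq> {(x, y) \<in> V \<times> V. x < y}"
    and "\<And>x x' y. (x, y) \<in> E \<Longrightarrow> (x', y) \<in> E \<Longrightarrow> x = x'"
    and "\<And>y. y \<in> V \<Longrightarrow> y \<noteq> x \<Longrightarrow> (x, y) \<in> E\<^sup>+"
  shows "labelled_tree (V, E)"
proof -
  have "(a, b) \<in> E\<^sup>+ \<or> (b, a) \<in> E\<^sup>+ \<or>
      (\<exists>z\<in>V. z \<noteq> a \<and> z \<noteq> b \<and> (z, a) \<in> E\<^sup>+ \<and> (z, b) \<in> E\<^sup>+)"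
    if "a \<in> V" "b \<in> V" "a \<noteq> b" for a b
    using that assms(2,5) by metis
  then show ?thesis
    using assms(1-4) unfolding labelled_tree_def prod.case by blast
qed

lemma has_shape_NodeE:
  assumes "has_shape E x t"
  obtains f where "t = Node (image_mset f (mset_set (children E x)))"
    and "\<And>y. (x, y) \<in> E \<Longrightarrow> has_shape E y (f y)"
  using assms by (cases rule: has_shape.cases) (rule that; blast)

lemma has_shape_unique:
  assumes "has_shape E x t" "has_shape E x t'"
  shows "t = t'"
  using assms
proof (induction arbitrary: t' rule: has_shape.induct)
  case (1 x f)
  obtain f' where t': "t' = Node (image_mset f' (mset_set (children E x)))"
    and f': "\<And>y. (x, y) \<in> E \<Longrightarrow> has_shape E y (f' y)"
    using has_shape_NodeE[OF 1(3)] by metis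
  have "image_mset f (mset_set (children E x)) = image_mset f' (mset_set (children E x))"
    using 1(2) f' by (cases "finite (children E x)") (auto intro!: image_mset_cong)
  then show ?case using t' by simp
qed

lemma has_shape_ex:
  assumes "forest_edges E"
  shows "\<exists>t. has_shape E x t"
proof -
  have "wf (E\<inverse>)"
    using assms forest_trancl_less[OF assms]
    by (intro finite_acyclic_wf_converse) (force simp: forest_edges_def acyclic_def)+
  then show ?thesis
  proof (induction x)
    case (less x)
    then have "\<forall>y. \<exists>t. (x, y) \<in> E \<longrightarrow> has_shape E y t" by blast
    then obtain f where "\<forall>y. (x, y) \<in> E \<longrightarrow> has_shape E y (f y)" by metis
    then have "has_shape E x (Node (image_mset f (mset_set (children E x))))"
      by (intro has_shape.intros) blast
    then show ?case by blast
  qed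
qed

lemma has_shape_cong:
  assumes "has_shape E x t" "x \<in> D"
    and "\<And>u. u \<in> D \<Longrightarrow> children E u \<subseteq> D \<and> children E u = children E' u"
  shows "has_shape E' x t"
  using assms(1,2)
proof (induction rule: has_shape.induct)
  case (1 x f)
  then have eq: "children E x = children E' x" and sub: "children E x \<subseteq> D"
    using assms(3)[OF 1(3)] by blast+
  have "has_shape E' x (Node (image_mset f (mset_set (children E' x))))"
  proof (rule has_shape.intros)
    fix y assume "(x, y) \<in> E'"
    then have "y \<in> children E x" using eq by blast
    then show "has_shape E' y (f y)" using 1(2) sub by blast
  qed
  then show ?case using eq by simp
qed

lemma represents_ex:
  assumes "labelled_tree G"
  shows "\<exists>!t. represents G t"
  using has_shape_ex[OF labelled_tree_forest[OF assms]] labelled_tree_root[OF assms]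
    labelled_tree_root_unique[OF assms] has_shape_unique assms
  unfolding represents_def by metis

lemma represents_graft:
  assumes G: "represents (V, E) (Node M)" and H: "represents (V', E') s"
    and less: "\<And>u v. u \<in> V \<Longrightarrow> v \<in> V' \<Longrightarrow> u < v"
  shows "\<exists>E''. represents (V \<union> V', E'') (Node (add_mset s M))"
proof -
  obtain x x' where x: "is_root (V, E) x" "has_shape E x (Node M)"
    and x': "is_root (V', E') x'" "has_shape E' x' s"
    using G H by (auto simp: represents_def)
  have lt: "labelled_tree (V, E)" "labelled_tree (V', E')"
    using G H by (auto simp: represents_def)
  have F: "forest_edges E" "forest_edges E'"
    using lt labelled_tree_forest by fastforce+
  have V: "\<And>u v. (u, v) \<in> E \<Longrightarrow> u \<in> V \<and> v \<in> V" "\<And>u v. (u, v) \<in> E' \<Longrightarrow> u \<in> V' \<and> v \<in> V'"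
    using labelled_tree_edges[OF lt(1)] labelled_tree_edges[OF lt(2)] by auto
  have disj: "V \<inter> V' = {}" using less by force
  have xV: "x \<in> V" "x' \<in> V'" using x x' by (auto simp: is_root_def)
  have noroot: "(u, x) \<notin> E" "(u, x') \<notin> E'" for u
  proof -
    have min: "x = Min V" "x' = Min V'"
      using labelled_tree_root_unique[OF lt(1) x(1)] labelled_tree_root_unique[OF lt(2) x'(1)]
      by auto
    have fin: "finite V" "finite V'" using lt by (auto simp: labelled_tree_def)
    show "(u, x) \<notin> E"
    proof
      assume e: "(u, x) \<in> E"
      then have "x \<le> u" using V(1) Min_le[OF fin(1)] min(1) by metis
      then show False using e F(1) unfolding forest_edges_def by fastforce
    qed
    show "(u, x') \<notin> E'"
    proof
      assume e: "(u, x') \<in> E'"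
      then have "x' \<le> u" using V(2) Min_le[OF fin(2)] min(2) by metis
      then show False using e F(2) unfolding forest_edges_def by fastforce
    qed
  qed
  define E'' where "E'' = E \<union> E' \<union> {(x, x')}"
  have reachV: "(x, y) \<in> E''\<^sup>+" if "y \<in> V" "y \<noteq> x" for y
  proof -
    have "(x, y) \<in> E\<^sup>+" using x(1) that by (auto simp: is_root_def)
    then show ?thesis by (rule trancl_mono) (auto simp: E''_def)
  qed
  have reachV': "(x, y) \<in> E''\<^sup>+" if "y \<in> V'" for y
  proof -
    have 1: "(x, x') \<in> E''\<^sup>+" by (auto simp: E''_def)
    show ?thesis
    proof (cases "y = x'")
      case False
      then have "(x', y) \<in> E'\<^sup>+" using x'(1) that by (auto simp: is_root_def)
      then have "(x', y) \<in> E''\<^sup>+" by (rule trancl_mono) (auto simp: E''_def)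
      with 1 show ?thesis by (rule trancl_trans)
    qed (use 1 in simp)
  qed
  have lt'': "labelled_tree (V \<union> V', E'')"
  proof (rule labelled_treeI[of _ x])
    show "finite (V \<union> V')" using lt by (auto simp: labelled_tree_def)
    show "E'' \<subseteq> {(x, y) \<in> (V \<union> V') \<times> (V \<union> V'). x < y}"
      using V F less xV by (auto simp: E''_def forest_edges_def)
    show "u = u'" if "(u, v) \<in> E''" "(u', v) \<in> E''" for u u' v
      using that V F disj noroot xV unfolding E''_def forest_edges_def by blast
    show "(x, y) \<in> E''\<^sup>+" if "y \<in> V \<union> V'" "y \<noteq> x" for y
      using that reachV reachV' by blast
  qed (use xV in auto)
  have root: "is_root (V \<union> V', E'') x"
    using reachV reachV' xV by (auto simp: is_root_def)
  obtain f where M: "M = image_mset f (mset_set (children E x))"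
    and f: "\<And>y. (x, y) \<in> E \<Longrightarrow> has_shape E y (f y)"
    using has_shape_NodeE[OF x(2)] by (metis rtree.inject)
  have ch: "children E'' x = insert x' (children E x)"
    using V xV disj by (auto simp: E''_def)
  have notin: "x' \<notin> children E x" using V xV disj by blast
  have s: "has_shape E'' x' s"
  proof (rule has_shape_cong[OF x'(2), of V'])
    fix u assume "u \<in> V'"
    then show "children E' u \<subseteq> V' \<and> children E' u = children E'' u"
      using V xV disj unfolding E''_def by blast
  qed (rule xV)
  have fy: "has_shape E'' y (f y)" if "(x, y) \<in> E" for y
  proof (rule has_shape_cong[OF f[OF that], of "V - {x}"])
    show "y \<in> V - {x}" using that V noroot by blast
    fix u assume "u \<in> V - {x}"
    then show "children E u \<subseteq> V - {x} \<and> children E u = children E'' u"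
      using V xV disj noroot unfolding E''_def by blast
  qed
  have "has_shape E'' x (Node (image_mset (f(x' := s)) (mset_set (children E'' x))))"
    using ch s fy notin by (intro has_shape.intros) auto
  moreover have "image_mset (f(x' := s)) (mset_set (children E'' x)) = add_mset s M"
    using notin finite_children[OF F(1)] unfolding ch M
    by (auto intro!: image_mset_cong)
  ultimately show ?thesis
    using root lt'' unfolding represents_def by auto
qed

lemma represents_onto_above: "\<exists>V E. represents (V, E) t \<and> (\<forall>v\<in>V. a < v)"
proof (induction t arbitrary: a)
  case (Node M)
  then show ?case
  proof (induction M)
    case empty
    let ?x = "a + 1"
    have "has_shape {} ?x (Node (image_mset (\<lambda>_. undefined) (mset_set (children {} ?x))))"
      by (rule has_shape.intros) auto
    then have "represents ({?x}, {}) (Node {#})"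
      by (auto simp: represents_def labelled_tree_def is_root_def)
    then show ?case by force
  next
    case (add s M)
    obtain V E where VE: "represents (V, E) (Node M)" "\<forall>v\<in>V. a < v"
      using add.IH add.prems by (metis insert_iff set_mset_add_mset_insert)
    have "s \<in># add_mset s M" by simp
    from add.prems[OF this, of "max a (Max V)"]
    obtain V' E' where VE': "represents (V', E') s" "\<forall>v\<in>V'. max a (Max V) < v"
      by blast
    have fin: "finite V" using VE by (auto simp: represents_def labelled_tree_def)
    have less: "u < v" if "u \<in> V" "v \<in> V'" for u v
      using Max_ge[OF fin that(1)] VE'(2) that(2) by fastforce
    obtain E'' where E'': "represents (V \<union> V', E'') (Node (add_mset s M))"
      using represents_graft[OF VE(1) VE'(1) less] by blast
    have "\<forall>v\<in>V \<union> V'. a < v" using VE(2) VE'(2) by auto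
    with E'' show ?case by blast
  qed
qed

lemma represents_onto: "\<exists>G. represents G t"
  using represents_onto_above by blast

lemma image_mset_eq_bij:
  assumes "finite C" "finite C'" "image_mset f (mset_set C) = image_mset f' (mset_set C')"
  shows "\<exists>h. bij_betw h C C' \<and> (\<forall>c\<in>C. f' (h c) = f c)"
  using assms
proof (induction C arbitrary: C' rule: finite_induct)
  case empty
  then show ?case by (auto simp: mset_set_empty_iff bij_betw_def)
next
  case (insert c C)
  have "f c \<in># image_mset f (mset_set (insert c C))"
    using insert.hyps by simp
  then obtain c' where c': "c' \<in> C'" "f' c' = f c"
    using insert.prems by (auto simp del: mset_set.insert)
  have rm: "mset_set C' = add_mset c' (mset_set (C' - {c'}))"
    using c' insert.prems(1) by (simp add: mset_set.remove)
  have "image_mset f (mset_set C) = image_mset f' (mset_set (C' - {c'}))"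
    using insert.prems(2) insert.hyps c'(2) unfolding rm by simp
  with insert.IH[of "C' - {c'}"] insert.prems(1)
  obtain h where h: "bij_betw h C (C' - {c'})" "\<forall>c\<in>C. f' (h c) = f c"
    by auto
  have "bij_betw (h(c := c')) (insert c C) C'"
    using h(1) c'(1) insert.hyps(2) unfolding bij_betw_def inj_on_def
    by (auto simp: image_iff)
  moreover have "\<forall>d\<in>insert c C. f' ((h(c := c')) d) = f d"
    using h(2) c'(2) by simp
  ultimately show ?case by blast
qed

lemma has_shape_iso:
  assumes F: "forest_edges E" "forest_edges E'" and t: "has_shape E x t" "has_shape E' x' t"
  shows "\<exists>\<phi>. \<phi> x = x' \<and> bij_betw \<phi> (desc E x) (desc E' x') \<and>
    (\<forall>u\<in>desc E x. \<forall>v\<in>desc E x. (u, v) \<in> E \<longleftrightarrow> (\<phi> u, \<phi> v) \<in> E')"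
  using t
proof (induction arbitrary: x' rule: has_shape.induct)
  case (1 x f)
  let ?C = "children E x" and ?C' = "children E' x'"
  obtain f' where eq: "image_mset f (mset_set ?C) = image_mset f' (mset_set ?C')"
    and f': "\<And>y. (x', y) \<in> E' \<Longrightarrow> has_shape E' y (f' y)"
    using has_shape_NodeE[OF 1(3)] by (metis rtree.inject)
  obtain h where h: "bij_betw h ?C ?C'" "\<And>c. c \<in> ?C \<Longrightarrow> f' (h c) = f c"
    using image_mset_eq_bij[OF finite_children[OF F(1)] finite_children[OF F(2)] eq] by auto
  have hC: "(x', h c) \<in> E'" if "(x, c) \<in> E" for c
    using h(1) that by (auto simp: bij_betw_def)
  define Q where "Q c \<phi> \<longleftrightarrow> \<phi> c = h c \<and> bij_betw \<phi> (desc E c) (desc E' (h c)) \<and>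
    (\<forall>u\<in>desc E c. \<forall>v\<in>desc E c. (u, v) \<in> E \<longleftrightarrow> (\<phi> u, \<phi> v) \<in> E')" for c \<phi>
  have "\<exists>\<phi>. Q c \<phi>" if c: "(x, c) \<in> E" for c
  proof -
    have "has_shape E' (h c) (f c)" using f'[OF hC[OF c]] h(2) c by simp
    from 1(2)[OF c this] show ?thesis unfolding Q_def .
  qed
  then obtain \<Phi> where "\<And>c. (x, c) \<in> E \<Longrightarrow> Q c (\<Phi> c)" by metis
  then have \<Phi>: "\<And>c. (x, c) \<in> E \<Longrightarrow> \<Phi> c c = h c"
      "\<And>c. (x, c) \<in> E \<Longrightarrow> bij_betw (\<Phi> c) (desc E c) (desc E' (h c))"
      "\<And>c u v. (x, c) \<in> E \<Longrightarrow> u \<in> desc E c \<Longrightarrow> v \<in> desc E c \<Longrightarrow> (u, v) \<in> E \<longleftrightarrow> (\<Phi> c u, \<Phi> c v) \<in> E'"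
    unfolding Q_def by blast+
  define \<phi> where "\<phi> u = (if u = x then x' else \<Phi> (THE c. (x, c) \<in> E \<and> (c, u) \<in> E\<^sup>*) u)" for u
  have gt: "x < u" if "(x, c) \<in> E" "u \<in> desc E c" for c u
    using that F(1) forest_rtrancl_le[OF F(1), of c u] by (force simp: forest_edges_def)
  have gt': "x' < u" if "(x', c) \<in> E'" "u \<in> desc E' c" for c u
    using that F(2) forest_rtrancl_le[OF F(2), of c u] by (force simp: forest_edges_def)
  have \<phi>x: "\<phi> x = x'" by (simp add: \<phi>_def)
  have \<phi>: "\<phi> u = \<Phi> c u" if c: "(x, c) \<in> E" "u \<in> desc E c" for c u
  proof -
    have "(THE c. (x, c) \<in> E \<and> (c, u) \<in> E\<^sup>*) = c"
      using c forest_disjoint[OF F(1)] by (intro the_equality) auto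
    then show ?thesis using gt[OF c] by (simp add: \<phi>_def)
  qed
  have \<phi>D: "\<phi> u \<in> desc E' (h c)" if c: "(x, c) \<in> E" "u \<in> desc E c" for c u
    using \<phi>[OF c] \<Phi>(2)[OF c(1)] c(2) by (metis bij_betwE)
  have same: "c = d" if "(x, c) \<in> E" "(x, d) \<in> E" "w \<in> desc E' (h c)" "w \<in> desc E' (h d)" for c d w
  proof -
    have "h c = h d" using that hC forest_disjoint[OF F(2)] by blast
    then show ?thesis using h(1) that by (auto simp: bij_betw_def inj_on_def)
  qed
  have cases_D: "u = x \<or> (\<exists>c. (x, c) \<in> E \<and> u \<in> desc E c)" if "u \<in> desc E x" for u
    using that desc_unfold[of E x] by auto
  have im: "\<phi> ` desc E c = desc E' (h c)" if "(x, c) \<in> E" for c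
    using \<phi>[OF that] \<Phi>(2)[OF that] by (auto simp: bij_betw_def)
  have surj: "\<phi> ` desc E x = desc E' x'"
  proof -
    have "\<phi> ` desc E x = insert x' (\<Union>c\<in>?C. \<phi> ` desc E c)"
      by (subst desc_unfold) (simp add: \<phi>x image_UN)
    also have "\<dots> = insert x' (\<Union>c\<in>?C. desc E' (h c))" using im by auto
    also have "\<dots> = insert x' (\<Union>c\<in>?C'. desc E' c)"
      using bij_betw_imp_surj_on[OF h(1)] by (metis (no_types, lifting) SUP_cong UN_simps(10))
    also have "\<dots> = desc E' x'" by (subst (2) desc_unfold) simp
    finally show ?thesis .
  qed
  have inj: "inj_on \<phi> (desc E x)"
  proof (rule inj_onI)
    fix u v assume uv: "u \<in> desc E x" "v \<in> desc E x" "\<phi> u = \<phi> v"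
    have ne: "\<phi> w \<noteq> x'" if "(x, c) \<in> E" "w \<in> desc E c" for c w
      using gt'[OF hC[OF that(1)] \<phi>D[OF that]] by simp
    show "u = v"
    proof (cases "u = x \<or> v = x")
      case True
      then show ?thesis using cases_D[OF uv(1)] cases_D[OF uv(2)] ne uv(3) \<phi>x by metis
    next
      case False
      then obtain c d where cd: "(x, c) \<in> E" "u \<in> desc E c" "(x, d) \<in> E" "v \<in> desc E d"
        using cases_D uv by metis
      then have "c = d" using same \<phi>D uv(3) by metis
      then show ?thesis
        using cd uv(3) \<phi> \<Phi>(2)[of c] unfolding bij_betw_def inj_on_def by metis
    qed
  qed
  have edge: "(u, v) \<in> E \<longleftrightarrow> (\<phi> u, \<phi> v) \<in> E'" if uv: "u \<in> desc E x" "v \<in> desc E x" for u v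
  proof (cases "v = x")
    case True
    have "x \<le> u" "x' \<le> \<phi> u"
      using uv(1) surj forest_rtrancl_le[OF F(1)] forest_rtrancl_le[OF F(2)] by blast+
    then show ?thesis using True \<phi>x F by (fastforce simp: forest_edges_def)
  next
    case False
    then obtain d where d: "(x, d) \<in> E" "v \<in> desc E d" using cases_D uv by metis
    show ?thesis
    proof (cases "u = x")
      case True
      have "(x, v) \<in> E \<longleftrightarrow> v = d"
        using d forest_disjoint[OF F(1), of x v d v] by auto
      also have "\<dots> \<longleftrightarrow> \<phi> v = h d"
        using d \<phi>[of d] \<Phi>(1,2)[of d] unfolding bij_betw_def inj_on_def
        by (metis Image_singleton_iff rtrancl.rtrancl_refl)
      also have "\<dots> \<longleftrightarrow> (x', \<phi> v) \<in> E'"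
      proof
        show "(x', \<phi> v) \<in> E'" if "\<phi> v = h d" using that hC[OF d(1)] by simp
        assume "(x', \<phi> v) \<in> E'"
        then show "\<phi> v = h d"
          by (rule forest_disjoint[OF F(2) _ hC[OF d(1)]]) (use \<phi>D[OF d] in simp_all)
      qed
      finally show ?thesis using True \<phi>x by simp
    next
      case False
      then obtain c where c: "(x, c) \<in> E" "u \<in> desc E c" using cases_D uv by metis
      show ?thesis
      proof (cases "c = d")
        case True
        then show ?thesis using c d \<phi> \<Phi>(3) by metis
      next
        case False
        have "(u, v) \<notin> E"
        proof
          assume "(u, v) \<in> E"
          then have "(c, v) \<in> E\<^sup>*" using c(2) by simp
          then show False using False forest_disjoint[OF F(1) c(1) d(1)] d(2) by blast
        qed
        moreover have "(\<phi> u, \<phi> v) \<notin> E'"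
        proof
          assume "(\<phi> u, \<phi> v) \<in> E'"
          then have "\<phi> v \<in> desc E' (h c)" using \<phi>D[OF c] by simp
          then show False using False same[OF c(1) d(1)] \<phi>D[OF d] by blast
        qed
        ultimately show ?thesis by simp
      qed
    qed
  qed
  show ?case using \<phi>x inj surj edge unfolding bij_betw_def by blast
qed

lemma has_shape_lt_iso:
  assumes "has_shape E x t" "desc E x \<subseteq> V" "inj_on \<phi> V" "E \<subseteq> V \<times> V"
  shows "has_shape (map_prod \<phi> \<phi> ` E) (\<phi> x) t"
  using assms(1,2)
proof (induction rule: has_shape.induct)
  case (1 x f)
  let ?E' = "map_prod \<phi> \<phi> ` E"
  have xV: "x \<in> V" using 1(3) by auto
  have CV: "children E x \<subseteq> V" using 1(3) by auto
  have ch: "children ?E' (\<phi> x) = \<phi> ` children E x"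
  proof
    show "children ?E' (\<phi> x) \<subseteq> \<phi> ` children E x"
    proof
      fix w assume "w \<in> children ?E' (\<phi> x)"
      then obtain u v where uv: "(u, v) \<in> E" "\<phi> u = \<phi> x" "w = \<phi> v" by auto
      then have "u = x" using assms(3,4) xV by (auto dest: inj_onD)
      then show "w \<in> \<phi> ` children E x" using uv by auto
    qed
  qed force
  define \<psi> where "\<psi> = inv_into V \<phi>"
  have \<psi>: "\<psi> (\<phi> c) = c" if "(x, c) \<in> E" for c
    using that CV assms(3) by (auto simp: \<psi>_def)
  have inj: "inj_on \<phi> (children E x)" using assms(3) CV by (rule inj_on_subset)
  have "has_shape ?E' (\<phi> x) (Node (image_mset (f \<circ> \<psi>) (mset_set (children ?E' (\<phi> x)))))"
  proof (rule has_shape.intros)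
    fix w assume "(\<phi> x, w) \<in> ?E'"
    then have "w \<in> children ?E' (\<phi> x)" by simp
    then obtain c where c: "(x, c) \<in> E" "w = \<phi> c" unfolding ch by auto
    have "desc E c \<subseteq> V" using 1(3) c(1) by (auto intro: converse_rtrancl_into_rtrancl)
    then show "has_shape ?E' w ((f \<circ> \<psi>) w)" using 1(2) c \<psi> by auto
  qed
  moreover have "image_mset (f \<circ> \<psi>) (mset_set (children ?E' (\<phi> x))) =
      image_mset f (mset_set (children E x))"
  proof -
    have "mset_set (children ?E' (\<phi> x)) = image_mset \<phi> (mset_set (children E x))"
      unfolding ch using inj by (simp add: image_mset_mset_set)
    then have "image_mset (f \<circ> \<psi>) (mset_set (children ?E' (\<phi> x))) =
        image_mset (f \<circ> \<psi> \<circ> \<phi>) (mset_set (children E x))"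
      by (simp add: multiset.map_comp)
    also have "\<dots> = image_mset f (mset_set (children E x))"
      using \<psi> by (cases "finite (children E x)") (auto intro!: image_mset_cong)
    finally show ?thesis .
  qed
  ultimately show ?case by simp
qed

lemma represents_iff_iso:
  assumes G: "represents G t" and H: "labelled_tree H"
  shows "represents H t \<longleftrightarrow> lt_iso G H"
proof
  assume Ht: "represents H t"
  obtain x x' where x: "is_root G x" "has_shape (snd G) x t"
    and x': "is_root H x'" "has_shape (snd H) x' t"
    using G Ht by (auto simp: represents_def)
  have lt: "labelled_tree G" using G by (simp add: represents_def)
  obtain \<phi> where bij: "bij_betw \<phi> (fst G) (fst H)"
    and edge: "\<And>u v. u \<in> fst G \<Longrightarrow> v \<in> fst G \<Longrightarrow> (u, v) \<in> snd G \<longleftrightarrow> (\<phi> u, \<phi> v) \<in> snd H"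
    using has_shape_iso[OF labelled_tree_forest[OF lt] labelled_tree_forest[OF H] x(2) x'(2)]
      labelled_tree_desc[OF lt x(1)] labelled_tree_desc[OF H x'(1)] by metis
  have "map_prod \<phi> \<phi> ` snd G = snd H"
  proof
    show "map_prod \<phi> \<phi> ` snd G \<subseteq> snd H"
      using edge labelled_tree_edges[OF lt] by auto
    show "snd H \<subseteq> map_prod \<phi> \<phi> ` snd G"
    proof
      fix p assume p: "p \<in> snd H"
      then have "fst p \<in> \<phi> ` fst G" "snd p \<in> \<phi> ` fst G"
        using labelled_tree_edges[OF H, of "fst p" "snd p"] bij by (auto simp: bij_betw_def)
      then obtain u v where uv: "u \<in> fst G" "v \<in> fst G" "p = (\<phi> u, \<phi> v)"
        by (metis imageE prod.collapse)
      then have "(u, v) \<in> snd G" using edge p by blast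
      then show "p \<in> map_prod \<phi> \<phi> ` snd G" using uv by force
    qed
  qed
  then show "lt_iso G H" using bij by (auto simp: lt_iso_def)
next
  assume "lt_iso G H"
  then obtain \<phi> where bij: "bij_betw \<phi> (fst G) (fst H)" and E: "snd H = map_prod \<phi> \<phi> ` snd G"
    by (auto simp: lt_iso_def)
  obtain x where x: "is_root G x" "has_shape (snd G) x t" and lt: "labelled_tree G"
    using G by (auto simp: represents_def)
  have "has_shape (snd H) (\<phi> x) t"
    unfolding E
    by (rule has_shape_lt_iso[OF x(2), of "fst G"])
      (use labelled_tree_desc[OF lt x(1)] labelled_tree_edges[OF lt] bij in \<open>auto simp: bij_betw_def\<close>)
  moreover have "is_root H (\<phi> x)"
  proof -
    have tr: "(\<phi> u, \<phi> v) \<in> (snd H)\<^sup>+" if "(u, v) \<in> (snd G)\<^sup>+" for u v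
      using that
    proof (induction rule: trancl_induct)
      case (base v)
      then have "(\<phi> u, \<phi> v) \<in> snd H" unfolding E by force
      then show ?case by auto
    next
      case (step v w)
      then have "(\<phi> v, \<phi> w) \<in> snd H" unfolding E by force
      then show ?case using step by (meson trancl.simps)
    qed
    have im: "\<phi> ` fst G = fst H" using bij by (simp add: bij_betw_def)
    show ?thesis unfolding is_root_def
    proof
      show "\<phi> x \<in> fst H" using im x(1) by (auto simp: is_root_def)
      show "\<forall>w\<in>fst H - {\<phi> x}. (\<phi> x, w) \<in> (snd H)\<^sup>+"
      proof
        fix w assume w: "w \<in> fst H - {\<phi> x}"
        then obtain v where v: "v \<in> fst G" "w = \<phi> v" using im by blast
        then have "v \<noteq> x" using w by blast
        then have "(x, v) \<in> (snd G)\<^sup>+" using v(1) x(1) by (auto simp: is_root_def)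
        then show "(\<phi> x, w) \<in> (snd H)\<^sup>+" unfolding v(2) by (rule tr)
      qed
    qed
  qed
  ultimately show "represents H t" using H by (auto simp: represents_def)
qed

lemma desc_finite:
  assumes "forest_edges E"
  shows "finite (desc E x)"
proof (rule finite_subset)
  show "desc E x \<subseteq> insert x (Range E)"
    by (auto elim: rtranclE)
  show "finite (insert x (Range E))"
    using assms by (simp add: forest_edges_def finite_Range)
qed

lemma has_shape_card:
  assumes F: "forest_edges E" and "has_shape E x t"
  shows "card (desc E x) = tree_order t"
  using assms(2)
proof (induction rule: has_shape.induct)
  case (1 x f)
  let ?C = "children E x"
  have fin: "finite ?C" "\<And>c. finite (desc E c)"
    using finite_children[OF F] desc_finite[OF F] by auto
  have x: "x \<notin> (\<Union>c\<in>?C. desc E c)"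
  proof
    assume "x \<in> (\<Union>c\<in>?C. desc E c)"
    then obtain c where c: "(x, c) \<in> E" "(c, x) \<in> E\<^sup>*" by blast
    then have "c \<le> x" using forest_rtrancl_le[OF F] by blast
    then show False using c(1) F unfolding forest_edges_def by fastforce
  qed
  have "desc E c \<inter> desc E d = {}" if "c \<in> ?C" "d \<in> ?C" "c \<noteq> d" for c d
    using that forest_disjoint[OF F] by blast
  then have "card (\<Union>c\<in>?C. desc E c) = (\<Sum>c\<in>?C. card (desc E c))"
    using fin by (intro card_UN_disjoint) auto
  also have "\<dots> = (\<Sum>c\<in>?C. tree_order (f c))"
    using 1(2) by (intro sum.cong) auto
  finally have "card (desc E x) = 1 + (\<Sum>c\<in>?C. tree_order (f c))"
    using x fin by (subst desc_unfold) simp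
  then show ?case
    by (simp add: sum_unfold_sum_mset multiset.map_comp comp_def)
qed

lemma represents_card:
  assumes "represents G t"
  shows "card (fst G) = tree_order t"
proof -
  obtain x where x: "is_root G x" "has_shape (snd G) x t" and G: "labelled_tree G"
    using assms by (auto simp: represents_def)
  show ?thesis
    using has_shape_card[OF labelled_tree_forest[OF G] x(2)] labelled_tree_desc[OF G x(1)]
    by simp
qed


end

theory Submission
  imports Defs
begin

text \<open>
  Both the exponential of \<open>W\<close> and the Runge--Kutta step are expanded into B-series, that is, sums over rooted
  trees \<open>t\<close> of a number depending on \<open>t\<close> times an elementary differential of \<open>W\<close> at the starting point.
  An elementary differential of a tree with \<open>r\<close> vertices contains \<open>W\<close> and its differentials \<open>r\<close> times and is
  bounded by \<open>\<rho>\<^sup>r\<close>, where \<open>\<rho>\<close> is the norm \<open>C_norm (m + 1) W\<close>.  So for \<open>\<rho> \<le> 1\<close> it is enough to compare the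
  coefficients of the trees with at most \<open>m\<close> vertices; for \<open>\<rho> > 1\<close> both steps are at most a multiple of \<open>\<rho>\<close>,
  hence of \<open>\<rho>\<^bsup>m + 1\<^esup>\<close>.

  The expansions rest on one estimate (\<open>bseries_compose\<close>): when an increment \<open>h\<close> equals a B-series up to an
  error of size \<open>\<rho>\<^bsup>q + 1\<^esup>\<close>, then \<open>W (y + h)\<close> equals the B-series obtained by grafting up to an error of size
  \<open>\<rho>\<^bsup>q + 2\<^esup>\<close>.  It is pointwise, and applies equally to the stages of the method, where it is combined with the
  stage equations (\<open>rk_field_expansion\<close>), and to the points of a solution of the differential equation, where it
  is combined with integration in time (\<open>flow_field_expansion\<close>).  The coefficient of a tree \<open>t\<close> is, up to a
  factor common to both sides, \<open>\<Sum>\<^sub>i b\<^sub>i \<Prod>\<^sub>k \<zeta>\<^sub>i(t\<^sub>k)\<close> for the method and \<open>1 / \<gamma>(t)\<close> for the flow, where the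
  density \<open>\<gamma>(t)\<close> is the product of the sizes of all subtrees.

  It remains to see that the order conditions say exactly that these two numbers agree.  This is the identity
  \<open>\<alpha>(t) \<sigma>(t) \<gamma>(t) = r(t)!\<close> (\<open>tree_alpha_formula\<close>), which is proved by counting the labelled trees of a given
  shape recursively: the second smallest vertex is always a child of the root, and the subtree above it is
  split off (\<open>card_represents_split\<close>).
\<close>

section \<open>Counting the labelled trees of a given shape\<close>

text \<open>
  Since edges increase, following parents from any vertex can only stop at the least one.  So the
  condition on paths in the definition of a labelled tree amounts to the existence of a parent for
  every other vertex, which can be checked edge by edge when trees are joined or cut.
\<close>

lemma labelled_tree_iff_parents:
  "labelled_tree (V, E) \<longleftrightarrow> finite V \<and> V \<noteq> {} \<and> (\<forall>(x, y)\<in>E. x \<in> V \<and> y \<in> V \<and> x < y) \<and>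
     (\<forall>x x' y. (x, y) \<in> E \<longrightarrow> (x', y) \<in> E \<longrightarrow> x = x') \<and>
     (\<forall>y\<in>V - {Min V}. \<exists>x. (x, y) \<in> E)"
  (is "?L \<longleftrightarrow> ?R")
proof
  assume L: ?L
  have root: "is_root (V, E) (Min V)" using labelled_tree_root[OF L] by simp
  have "\<exists>x. (x, y) \<in> E" if "y \<in> V - {Min V}" for y
  proof -
    have "(Min V, y) \<in> E\<^sup>+" using root that by (simp add: is_root_def)
    then show ?thesis by (meson tranclE)
  qed
  moreover have "finite V" "V \<noteq> {}" "E \<subseteq> {(x, y) \<in> V \<times> V. x < y}"
    "\<forall>x x' y. (x, y) \<in> E \<and> (x', y) \<in> E \<longrightarrow> x = x'"
    using L unfolding labelled_tree_def by simp_all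
  ultimately show ?R by blast
next
  assume R: ?R
  then have fin: "finite V" "V \<noteq> {}" by auto
  have reach: "y \<in> V \<Longrightarrow> y \<noteq> Min V \<Longrightarrow> (Min V, y) \<in> E\<^sup>+" for y
  proof (induction "card {u\<in>V. u < y}" arbitrary: y rule: less_induct)
    case less
    obtain x where x: "(x, y) \<in> E" using R less.prems by blast
    then have xV: "x \<in> V" "x < y" using R by auto
    show ?case
    proof (cases "x = Min V")
      case False
      have "card {u\<in>V. u < x} < card {u\<in>V. u < y}"
        using fin xV by (intro psubset_card_mono) auto
      then have "(Min V, x) \<in> E\<^sup>+" using less.hyps xV False by blast
      then show ?thesis using x by simp
    qed (use x in auto)
  qed
  show ?L
  proof (rule labelled_treeI[of V "Min V"])
    show "finite V" "Min V \<in> V" using fin by auto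
    show "E \<subseteq> {(x, y) \<in> V \<times> V. x < y}" using R by blast
    show "x = x'" if "(x, y) \<in> E" "(x', y) \<in> E" for x x' y using R that by blast
  qed (rule reach)
qed

lemma represents_iff_has_shape_Min:
  "represents (V, E) t \<longleftrightarrow> labelled_tree (V, E) \<and> has_shape E (Min V) t"
  using labelled_tree_root[of "(V, E)"] labelled_tree_root_unique[of "(V, E)"]
  by (auto simp: represents_def)

text \<open>
  The condition on the least vertices makes the edge between the two roots increasing and keeps the
  first root the least vertex of the joined tree.
\<close>

lemma represents_join:
  assumes G: "represents (V, E) (Node M)" and H: "represents (U, D) s"
    and disj: "V \<inter> U = {}" and less: "Min V < Min U"
  shows "represents (V \<union> U, insert (Min V, Min U) (E \<union> D)) (Node (add_mset s M))"
proof -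
  let ?r = "Min V" and ?v = "Min U" and ?F = "insert (Min V, Min U) (E \<union> D)"
  have G': "labelled_tree (V, E)" "has_shape E ?r (Node M)"
    and H': "labelled_tree (U, D)" "has_shape D ?v s"
    using G H by (auto simp: represents_iff_has_shape_Min)
  note GL = G'(1)[unfolded labelled_tree_iff_parents]
  note HL = H'(1)[unfolded labelled_tree_iff_parents]
  have E: "x \<in> V \<and> y \<in> V \<and> x < y" if "(x, y) \<in> E" for x y using GL that by auto
  have D: "x \<in> U \<and> y \<in> U \<and> x < y" if "(x, y) \<in> D" for x y using HL that by auto
  have fin: "finite V" "V \<noteq> {}" "finite U" "U \<noteq> {}" using GL HL by auto
  have r: "?r \<in> V" and v: "?v \<in> U" using fin by auto
  have noE: "(x, ?r) \<notin> E" for x using E Min_le[OF fin(1)] by (meson leD)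
  have noD: "(x, ?v) \<notin> D" for x using D Min_le[OF fin(3)] by (meson leD)
  have Min: "Min (V \<union> U) = ?r" using fin less by (simp add: Min_Un)
  have lt: "labelled_tree (V \<union> U, ?F)"
    unfolding labelled_tree_iff_parents
  proof (intro conjI)
    show "\<forall>(x, y)\<in>?F. x \<in> V \<union> U \<and> y \<in> V \<union> U \<and> x < y"
      using E D r v less by auto
    show "\<forall>x x' y. (x, y) \<in> ?F \<longrightarrow> (x', y) \<in> ?F \<longrightarrow> x = x'"
    proof (intro allI impI)
      fix x x' y assume xy: "(x, y) \<in> ?F" "(x', y) \<in> ?F"
      have e: "x = x'" if "(x, y) \<in> E" "(x', y) \<in> E" using GL that by blast
      have d: "x = x'" if "(x, y) \<in> D" "(x', y) \<in> D" using HL that by blast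
      show "x = x'" using xy e d noD E D v disj by blast
    qed
    show "\<forall>y\<in>V \<union> U - {Min (V \<union> U)}. \<exists>x. (x, y) \<in> ?F"
    proof
      fix y assume y: "y \<in> V \<union> U - {Min (V \<union> U)}"
      consider "y \<in> V - {?r}" | "y \<in> U - {?v}" | "y = ?v" using y Min by auto
      then show "\<exists>x. (x, y) \<in> ?F" using GL HL by cases blast+
    qed
  qed (use fin in auto)
  obtain f where M: "M = image_mset f (mset_set (children E ?r))"
    and f: "\<And>y. (?r, y) \<in> E \<Longrightarrow> has_shape E y (f y)"
    using has_shape_NodeE[OF G'(2)] by (metis rtree.inject)
  have ch: "children ?F ?r = insert ?v (children E ?r)"
    using D r disj by auto
  have notin: "?v \<notin> children E ?r" using E v disj by blast
  have s: "has_shape ?F ?v s"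
  proof (rule has_shape_cong[OF H'(2), of U])
    fix u assume "u \<in> U"
    then show "children D u \<subseteq> U \<and> children D u = children ?F u"
      using D E r disj by blast
  qed (rule v)
  have fy: "has_shape ?F y (f y)" if y: "(?r, y) \<in> E" for y
  proof (rule has_shape_cong[OF f[OF y], of "V - {?r}"])
    show "y \<in> V - {?r}" using y E noE by blast
    fix u assume "u \<in> V - {?r}"
    then show "children E u \<subseteq> V - {?r} \<and> children E u = children ?F u"
      using D E noE disj by blast
  qed
  have "has_shape ?F ?r (Node (image_mset (f(?v := s)) (mset_set (children ?F ?r))))"
    using ch s fy notin by (intro has_shape.intros) auto
  moreover have "finite (children E ?r)"
    using E by (intro finite_subset[OF _ fin(1)]) auto
  then have "image_mset (f(?v := s)) (mset_set (children ?F ?r)) = add_mset s M"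
    using notin unfolding ch M by (auto intro!: image_mset_cong)
  ultimately show ?thesis
    using lt Min by (simp add: represents_iff_has_shape_Min)
qed

text \<open>
  Cutting is the inverse of joining.  The second smallest vertex \<open>v\<close> has a parent below it, so it is a
  child of the root; the part of the tree above \<open>v\<close> is detached.  The choice of \<open>v\<close> makes the
  decomposition unique.
\<close>

lemma represents_cut:
  assumes G: "represents (V, E) (Node M)" and nonempty: "V - {Min V} \<noteq> {}"
  defines "v \<equiv> Min (V - {Min V})"
  defines "U \<equiv> desc E v"
  obtains s where "s \<in># M" "represents (U, E \<inter> U \<times> U) s"
    "represents (V - U, E \<inter> (V - U) \<times> (V - U)) (Node (M - {#s#}))"
    "v \<in> U" "U \<subseteq> V - {Min V}"
    "E = insert (Min V, v) (E \<inter> (V - U) \<times> (V - U) \<union> E \<inter> U \<times> U)"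
proof -
  let ?r = "Min V"
  let ?D = "E \<inter> U \<times> U" and ?E = "E \<inter> (V - U) \<times> (V - U)"
  have lt: "labelled_tree (V, E)" and sh: "has_shape E ?r (Node M)"
    using G by (auto simp: represents_iff_has_shape_Min)
  note L = lt[unfolded labelled_tree_iff_parents]
  have E: "x \<in> V \<and> y \<in> V \<and> x < y" if "(x, y) \<in> E" for x y using L that by auto
  have uniq: "x = x'" if "(x, y) \<in> E" "(x', y) \<in> E" for x x' y using L that by blast
  have fin: "finite V" "V \<noteq> {}" using L by auto
  have F: "forest_edges E" using labelled_tree_forest[OF lt] by simp
  have r: "?r \<in> V" using fin by auto
  have v: "v \<in> V" "v \<noteq> ?r" using fin nonempty Min_in[of "V - {?r}"] by (auto simp: v_def)
  have vmin: "v \<le> y" if "y \<in> V" "y \<noteq> ?r" for y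
    using that fin unfolding v_def by (intro Min_le) auto
  have noE: "(x, ?r) \<notin> E" for x using E Min_le[OF fin(1)] by (meson leD)
  have rv: "(?r, v) \<in> E"
  proof -
    obtain x where x: "(x, v) \<in> E" using L v by blast
    then have "x = ?r" using E[OF x] vmin by (meson leD)
    then show ?thesis using x by simp
  qed
  have Uge: "v \<le> u" if "u \<in> U" for u using that forest_rtrancl_le[OF F] by (auto simp: U_def)
  have rlt: "?r < v" using E[OF rv] by simp
  have vU: "v \<in> U" by (simp add: U_def)
  have UV: "U \<subseteq> V - {?r}"
  proof
    fix u assume u: "u \<in> U"
    then have "(v, u) \<in> E\<^sup>*" by (simp add: U_def)
    then have "u \<in> V" by (rule rtranclE) (use v E in blast)+
    then show "u \<in> V - {?r}" using Uge[OF u] rlt by auto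
  qed
  have down: "y \<in> U" if "(x, y) \<in> E" "x \<in> U" for x y
    using that by (auto simp: U_def intro: rtrancl_into_rtrancl)
  have up: "x \<in> U" if xy: "(x, y) \<in> E" "y \<in> U" "y \<noteq> v" for x y
  proof -
    have "(v, y) \<in> E\<^sup>*" using xy by (simp add: U_def)
    then obtain z where "(v, z) \<in> E\<^sup>*" "(z, y) \<in> E" using xy(3) by (blast elim: rtranclE)
    then show ?thesis using uniq xy(1) by (auto simp: U_def)
  qed
  have MinU: "Min U = v" using Uge vU finite_subset[OF UV] fin by (intro Min_eqI) auto
  have rVU: "?r \<in> V - U" using r UV by blast
  have MinVU: "Min (V - U) = ?r" using fin rVU by (intro Min_eqI) auto
  obtain f where M: "M = image_mset f (mset_set (children E ?r))"
    and f: "\<And>y. (?r, y) \<in> E \<Longrightarrow> has_shape E y (f y)"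
    using has_shape_NodeE[OF sh] by (metis rtree.inject)
  have finc: "finite (children E ?r)" using finite_children[OF F] .
  have split: "mset_set (children E ?r) = add_mset v (mset_set (children E ?r - {v}))"
    using rv finc by (simp add: mset_set.remove)
  have "f v \<in># M" using rv finc by (simp add: M)
  moreover have "represents (U, ?D) (f v)"
    unfolding represents_iff_has_shape_Min MinU
  proof
    show "labelled_tree (U, ?D)"
      unfolding labelled_tree_iff_parents MinU
    proof (intro conjI)
      show "\<forall>y\<in>U - {v}. \<exists>x. (x, y) \<in> ?D"
      proof
        fix y assume y: "y \<in> U - {v}"
        then have "y \<in> V - {?r}" using UV by blast
        then obtain x where "(x, y) \<in> E" using L by blast
        then show "\<exists>x. (x, y) \<in> ?D" using up y by blast
      qed
      show "\<forall>x x' y. (x, y) \<in> ?D \<longrightarrow> (x', y) \<in> ?D \<longrightarrow> x = x'" using uniq by blast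
    qed (use E vU finite_subset[OF UV] fin in auto)
    show "has_shape ?D v (f v)"
      by (rule has_shape_cong[OF f[OF rv], of U]) (use vU down in auto)
  qed
  moreover have "represents (V - U, ?E) (Node (M - {#f v#}))"
    unfolding represents_iff_has_shape_Min MinVU
  proof
    show "labelled_tree (V - U, ?E)"
      unfolding labelled_tree_iff_parents MinVU
    proof (intro conjI)
      show "\<forall>y\<in>V - U - {?r}. \<exists>x. (x, y) \<in> ?E"
      proof
        fix y assume y: "y \<in> V - U - {?r}"
        then obtain x where "(x, y) \<in> E" using L by blast
        then show "\<exists>x. (x, y) \<in> ?E" using E down y by blast
      qed
      show "\<forall>x x' y. (x, y) \<in> ?E \<longrightarrow> (x', y) \<in> ?E \<longrightarrow> x = x'" using uniq by blast
      show "V - U \<noteq> {}" using rVU by blast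
    qed (use E fin in auto)
    have ch: "children ?E ?r = children E ?r - {v}"
      using E rVU up vU by blast
    have "has_shape ?E ?r (Node (image_mset f (mset_set (children ?E ?r))))"
    proof (rule has_shape.intros)
      fix y assume y: "(?r, y) \<in> ?E"
      show "has_shape ?E y (f y)"
      proof (rule has_shape_cong[OF f, of _ "V - U - {?r}"])
        fix u assume u: "u \<in> V - U - {?r}"
        have "children E u \<subseteq> V - U - {?r}"
        proof
          fix w assume "w \<in> children E u"
          then have w: "(u, w) \<in> E" by simp
          have "w \<noteq> v" using w rv uniq u by blast
          then show "w \<in> V - U - {?r}" using w E noE up u by blast
        qed
        then show "children E u \<subseteq> V - U - {?r} \<and> children E u = children ?E u"
          using u by blast
      qed (use y noE in auto)
    qed
    moreover have "M - {#f v#} = image_mset f (mset_set (children ?E ?r))"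
      unfolding M ch split by simp
    ultimately show "has_shape ?E ?r (Node (M - {#f v#}))" by simp
  qed
  moreover have "E = insert (?r, v) (?E \<union> ?D)"
  proof
    show "E \<subseteq> insert (?r, v) (?E \<union> ?D)"
    proof (rule subrelI)
      fix x y assume xy: "(x, y) \<in> E"
      show "(x, y) \<in> insert (?r, v) (?E \<union> ?D)"
      proof (cases "y = v")
        case True
        then show ?thesis using xy rv uniq by blast
      next
        case False
        then show ?thesis using xy up down E by blast
      qed
    qed
    show "insert (?r, v) (?E \<union> ?D) \<subseteq> E" using rv by blast
  qed
  ultimately show thesis using that vU UV by blast
qed


lemma represents_unique: "represents G t \<Longrightarrow> represents G t' \<Longrightarrow> t = t'"
  using represents_ex[of G] unfolding represents_def by blast

lemma finite_represents: "finite V \<Longrightarrow> finite {E. represents (V, E) t}"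
  by (rule finite_subset[of _ "Pow (V \<times> V)"])
    (auto simp: represents_iff_has_shape_Min labelled_tree_iff_parents)

text \<open>
  Cutting and joining give a bijection between the labelled trees on \<open>V\<close> of shape \<open>Node M\<close> and the
  choices of a child shape \<open>s\<close>, a vertex set \<open>U\<close> for it, and labelled trees of the two smaller shapes on
  \<open>U\<close> and on the rest.
\<close>

lemma card_represents_split:
  assumes V: "finite V" "V - {Min V} \<noteq> {}"
  defines "r \<equiv> Min V"
  defines "v \<equiv> Min (V - {r})"
  shows "card {E. represents (V, E) (Node M)} =
    (\<Sum>s\<in>set_mset M. \<Sum>U | v \<in> U \<and> U \<subseteq> V - {r} \<and> card U = tree_order s.
       card {D. represents (U, D) s} * card {E. represents (V - U, E) (Node (M - {#s#}))})"
proof -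
  define \<U> where "\<U> s = {U. v \<in> U \<and> U \<subseteq> V - {r} \<and> card U = tree_order s}" for s
  define A where "A U s = {D. represents (U, D) s}" for U s
  define B where "B U s = {E. represents (V - U, E) (Node (M - {#s#}))}" for U s
  define X where "X = (SIGMA s:set_mset M. SIGMA U:\<U> s. A U s \<times> B U s)"
  define join where "join = (\<lambda>(s :: rtree, U :: int set, D, E). insert (r, v) (E \<union> D))"
  have finU: "finite (\<U> s)" for s
    by (rule finite_subset[of _ "Pow V"]) (use V in \<open>auto simp: \<U>_def\<close>)
  have finA: "finite (A U s)" if "U \<in> \<U> s" for U s
    unfolding A_def by (rule finite_represents) (use that V finite_subset in \<open>auto simp: \<U>_def\<close>)
  have finB: "finite (B U s)" for U s
    unfolding B_def by (rule finite_represents) (use V in auto)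
  have rV: "r \<in> V" using V unfolding r_def by (intro Min_in) auto
  have vV: "v \<in> V - {r}" using V unfolding v_def r_def by (intro Min_in) auto
  have vmin: "v \<le> y" if "y \<in> V - {r}" for y using that V unfolding v_def by auto
  have rmin: "r \<le> y" if "y \<in> V" for y using that V unfolding r_def by auto
  have MinU: "Min U = v" if "U \<in> \<U> s" for U s
    using that vmin V by (intro Min_eqI) (auto simp: \<U>_def intro: finite_subset)
  have MinVU: "Min (V - U) = r" if "U \<in> \<U> s" for U s
    using that rmin rV V by (intro Min_eqI) (auto simp: \<U>_def)
  (* The pieces can be read off from the joined tree, which gives injectivity. *)
  have recover: "U = desc (join (s, U, D, E)) v \<and> D = join (s, U, D, E) \<inter> U \<times> U \<and>
      E = join (s, U, D, E) \<inter> (V - U) \<times> (V - U)"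
    if U: "U \<in> \<U> s" and D: "D \<in> A U s" and E: "E \<in> B U s" for s U D E
  proof -
    let ?F = "join (s, U, D, E)"
    have lt: "labelled_tree (U, D)" "labelled_tree (V - U, E)"
      using D E by (auto simp: A_def B_def represents_def)
    have sub: "D \<subseteq> U \<times> U" "E \<subseteq> (V - U) \<times> (V - U)"
      using lt by (auto simp: labelled_tree_iff_parents)
    have rvU: "r \<notin> U" "v \<in> U" using U by (auto simp: \<U>_def)
    have "desc D v = U"
      using labelled_tree_desc[OF lt(1) labelled_tree_root[OF lt(1)]] MinU[OF U] by simp
    moreover have "desc D v \<subseteq> desc ?F v"
      using rtrancl_mono[of D ?F] by (auto simp: join_def)
    moreover have "desc ?F v \<subseteq> U"
    proof
      fix u assume "u \<in> desc ?F v"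
      then have "(v, u) \<in> ?F\<^sup>*" by simp
      then show "u \<in> U"
        by (induction rule: rtrancl_induct) (use rvU sub in \<open>auto simp: join_def\<close>)
    qed
    ultimately show ?thesis using sub rvU by (auto simp: join_def)
  qed
  have "bij_betw join X {E. represents (V, E) (Node M)}"
    unfolding bij_betw_def
  proof
    show "inj_on join X"
    proof (rule inj_onI)
      fix p q assume pq: "p \<in> X" "q \<in> X" "join p = join q"
      obtain s U D E where p: "p = (s, U, D, E)" by (cases p)
      obtain s' U' D' E' where q: "q = (s', U', D', E')" by (cases q)
      have P: "U \<in> \<U> s" "D \<in> A U s" "E \<in> B U s" and Q: "U' \<in> \<U> s'" "D' \<in> A U' s'" "E' \<in> B U' s'"
        using pq p q by (auto simp: X_def)
      have "U = desc (join p) v" "U' = desc (join p) v"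
        using recover[OF P] recover[OF Q] pq(3) unfolding p q by metis+
      then have UU: "U = U'" by simp
      then have DE: "D = D'" "E = E'"
        using recover[OF P] recover[OF Q] pq(3) unfolding p q by metis+
      have "s = s'" using P Q UU DE represents_unique by (auto simp: A_def)
      then show "p = q" using p q UU DE by simp
    qed
    show "join ` X = {E. represents (V, E) (Node M)}"
    proof (intro equalityI subsetI)
      fix F assume "F \<in> join ` X"
      then obtain s U D E where F: "F = insert (r, v) (E \<union> D)"
        and s: "s \<in># M" and U: "U \<in> \<U> s" and DE: "D \<in> A U s" "E \<in> B U s"
        by (auto simp: X_def join_def)
      have "represents (V - U \<union> U, insert (Min (V - U), Min U) (E \<union> D))
          (Node (add_mset s (M - {#s#})))"
        by (rule represents_join)
          (use DE MinU[OF U] MinVU[OF U] rmin[of v] vV in \<open>auto simp: A_def B_def\<close>)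
      moreover have "V - U \<union> U = V" using U by (auto simp: \<U>_def)
      ultimately show "F \<in> {E. represents (V, E) (Node M)}"
        using F s MinU[OF U] MinVU[OF U] by simp
    next
      fix F assume "F \<in> {E. represents (V, E) (Node M)}"
      then have F: "represents (V, F) (Node M)" by simp
      define U where "U = desc F v"
      obtain s where s: "s \<in># M" "represents (U, F \<inter> U \<times> U) s"
        "represents (V - U, F \<inter> (V - U) \<times> (V - U)) (Node (M - {#s#}))"
        "v \<in> U" "U \<subseteq> V - {r}"
        "F = insert (r, v) (F \<inter> (V - U) \<times> (V - U) \<union> F \<inter> U \<times> U)"
        using represents_cut[OF F V(2)] unfolding U_def v_def r_def by metis
      have "U \<in> \<U> s" using s represents_card[OF s(2)] by (simp add: \<U>_def)
      then have "(s, U, F \<inter> U \<times> U, F \<inter> (V - U) \<times> (V - U)) \<in> X"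
        using s by (auto simp: X_def A_def B_def)
      moreover have "join (s, U, F \<inter> U \<times> U, F \<inter> (V - U) \<times> (V - U)) = F"
        using s(6) by (simp add: join_def)
      ultimately show "F \<in> join ` X" by (metis imageI)
    qed
  qed
  then have "card {E. represents (V, E) (Node M)} = card X"
    by (simp add: bij_betw_same_card)
  also have "\<dots> = (\<Sum>s\<in>set_mset M. card (SIGMA U:\<U> s. A U s \<times> B U s))"
    unfolding X_def using finU finA finB by (intro card_SigmaI) (auto intro!: finite_SigmaI)
  also have "\<dots> = (\<Sum>s\<in>set_mset M. \<Sum>U\<in>\<U> s. card (A U s) * card (B U s))"
    using finU finA finB by (intro sum.cong refl) (simp add: card_SigmaI)
  finally show ?thesis by (simp add: \<U>_def A_def B_def)
qed

text \<open>
  The product over all vertices of the number of vertices at or above them, usually written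
  \<open>\<gamma>(t)\<close>.
\<close>

fun tree_density :: "rtree \<Rightarrow> nat" where
  "tree_density (Node M) = tree_order (Node M) * \<Prod>\<^sub># (image_mset tree_density M)"

lemma tree_order_pos [simp]: "tree_order t > 0"
  by (cases t) simp

lemma tree_sigma_pos [simp]: "tree_sigma t > 0"
  by (induction t rule: tree_sigma.induct) (auto intro!: prod_pos)

lemma tree_density_pos [simp]: "tree_density t > 0"
proof (induction t rule: tree_density.induct)
  case (1 M)
  then have "\<Prod>\<^sub># (image_mset tree_density M) > 0"
    by (induction M) auto
  then show ?case by simp
qed

lemma tree_sigma_add:
  "tree_sigma (Node (add_mset s M)) =
     Suc (count M s) * tree_sigma s * tree_sigma (Node M)"
proof -
  define g where "g M t = fact (count M t) * tree_sigma t ^ count M t" for M t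
  have "tree_sigma (Node M) = prod (g M) (set_mset M)"
    by (simp add: g_def)
  also have "\<dots> = prod (g M) (insert s (set_mset M))"
    by (intro prod.mono_neutral_left) (auto simp: g_def not_in_iff)
  also have "\<dots> = g M s * prod (g M) (set_mset M - {s})"
    by (simp add: prod.insert_remove)
  finally have M: "tree_sigma (Node M) = \<dots>" .
  have "tree_sigma (Node (add_mset s M)) = prod (g (add_mset s M)) (insert s (set_mset M))"
    by (simp add: g_def)
  also have "\<dots> = g (add_mset s M) s * prod (g (add_mset s M)) (set_mset M - {s})"
    by (simp add: prod.insert_remove)
  also have "prod (g (add_mset s M)) (set_mset M - {s}) = prod (g M) (set_mset M - {s})"
    by (intro prod.cong) (auto simp: g_def)
  finally show ?thesis unfolding M by (simp add: g_def algebra_simps)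
qed

lemma card_subsets_containing:
  assumes "finite S" "v \<in> S" "k > 0"
  shows "card {U. v \<in> U \<and> U \<subseteq> S \<and> card U = k} = (card S - 1) choose (k - 1)"
proof -
  have "bij_betw (insert v) {U. U \<subseteq> S - {v} \<and> card U = k - 1}
      {U. v \<in> U \<and> U \<subseteq> S \<and> card U = k}"
  proof (rule bij_betw_byWitness[where f' = "\<lambda>U. U - {v}"])
    show "insert v ` {U. U \<subseteq> S - {v} \<and> card U = k - 1} \<subseteq> {U. v \<in> U \<and> U \<subseteq> S \<and> card U = k}"
    proof clarify
      fix U assume U: "U \<subseteq> S - {v}" "card U = k - 1"
      then have "finite U" "v \<notin> U" using assms finite_subset by auto
      then show "v \<in> insert v U \<and> insert v U \<subseteq> S \<and> card (insert v U) = k" using U assms by auto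
    qed
    show "(\<lambda>U. U - {v}) ` {U. v \<in> U \<and> U \<subseteq> S \<and> card U = k} \<subseteq> {U. U \<subseteq> S - {v} \<and> card U = k - 1}"
      by auto
  qed auto
  then have "card {U. v \<in> U \<and> U \<subseteq> S \<and> card U = k} = card {U. U \<subseteq> S - {v} \<and> card U = k - 1}"
    by (simp add: bij_betw_same_card)
  then show ?thesis using assms by (simp add: n_subsets)
qed

lemma sum_count_mult:
  fixes f :: "'a \<Rightarrow> nat"
  shows "(\<Sum>s\<in>set_mset M. count M s * f s) = \<Sum>\<^sub># (image_mset f M)"
proof (induction M)
  case (add x M)
  have "(\<Sum>s\<in>set_mset (add_mset x M). count (add_mset x M) s * f s) =
      (\<Sum>s\<in>insert x (set_mset M). count M s * f s + (if s = x then f s else 0))"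
    by (intro sum.cong) auto
  also have "\<dots> = (\<Sum>s\<in>insert x (set_mset M). count M s * f s) + f x"
    by (simp add: sum.distrib)
  also have "(\<Sum>s\<in>insert x (set_mset M). count M s * f s) = (\<Sum>s\<in>set_mset M. count M s * f s)"
    by (intro sum.mono_neutral_right) (auto simp: not_in_iff)
  finally show ?case using add.IH by simp
qed simp

text \<open>
  Write \<open>n\<close> for the order of \<open>t = Node M\<close> and \<open>k\<close> for that of a child shape \<open>s\<close>.  In the recursion given by
  the bijection above, there are \<open>n - 2\<close> choose \<open>k - 1\<close> possible vertex sets for \<open>s\<close>.  With the
  claimed formula for the two smaller shapes, the contribution of \<open>s\<close> becomes \<open>n! / (\<sigma>(t) \<gamma>(t))\<close> times
  \<open>k \<cdot> count M s / (n - 1)\<close>, and these fractions add up to \<open>1\<close> because the children together have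
  \<open>n - 1\<close> vertices.
\<close>

lemma card_represents:
  assumes "finite V" "card V = tree_order t"
  shows "card {E. represents (V, E) t} * tree_sigma t * tree_density t = fact (tree_order t)"
  using assms
proof (induction "tree_order t" arbitrary: t V rule: less_induct)
  case less
  obtain M where t: "t = Node M" by (cases t)
  define n where "n = tree_order t"
  show ?case
  proof (cases "M = {#}")
    case True
    then obtain v where v: "V = {v}" using less.prems t by (auto simp: card_1_singleton_iff)
    have "has_shape {} v (Node (image_mset (\<lambda>_. undefined) (mset_set (children {} v))))"
      by (rule has_shape.intros) auto
    then have "{E. represents (V, E) t} = {{}}"
      using True t v by (auto simp: represents_iff_has_shape_Min labelled_tree_iff_parents)
    then show ?thesis using t True by simp
  next
    case False
    then obtain s0 M0 where "M = add_mset s0 M0" by (meson multiset_cases)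
    then have n2: "n \<ge> 2" using tree_order_pos[of s0] by (simp add: n_def t Suc_le_eq del: tree_order_pos)
    have cV: "card V = n" using less.prems by (simp add: n_def)
    define r where "r = Min V"
    have "V \<noteq> {}" using cV n2 by auto
    then have rV: "r \<in> V" using less.prems by (simp add: r_def)
    have cV': "card (V - {r}) = n - 1" using rV cV less.prems by simp
    have ne: "V - {r} \<noteq> {}"
    proof
      assume "V - {r} = {}"
      then have "card (V - {r}) = 0" by (simp only: card.empty)
      then show False using cV' n2 by linarith
    qed
    define v where "v = Min (V - {r})"
    have vV: "v \<in> V - {r}" unfolding v_def by (rule Min_in) (use ne less.prems(1) in simp_all)
    let ?N = "\<lambda>V t. card {E. represents (V, E) t}"
    have *: "real (\<Sum>U | v \<in> U \<and> U \<subseteq> V - {r} \<and> card U = tree_order s.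
         ?N U s * ?N (V - U) (Node (M - {#s#}))) =
       fact n / (real (n - 1) * tree_sigma t * tree_density t) * (count M s * tree_order s)"
      if s: "s \<in># M" for s
    proof -
      obtain M' where M: "M = add_mset s M'" using s by (metis insert_DiffM)
      let ?k = "tree_order s" and ?t' = "Node M'"
      let ?l = "tree_order ?t'"
      have nkl: "n = ?k + ?l" by (simp add: n_def t M)
      have kl: "?k > 0" "?l > 0" by (rule tree_order_pos)+
      have "?N U s * ?N (V - U) (Node (M - {#s#})) =
          (fact ?k / (tree_sigma s * tree_density s)) *
          (fact ?l / (real (tree_sigma ?t') * tree_density ?t'))"
        if U: "v \<in> U" "U \<subseteq> V - {r}" "card U = ?k" for U
      proof -
        have fin: "finite U" using U less.prems finite_subset by (metis finite_Diff)
        have "?N U s * tree_sigma s * tree_density s = fact ?k"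
          using less.hyps[of s U] fin U(3) kl nkl by (simp add: n_def)
        moreover have "?N (V - U) ?t' * tree_sigma ?t' * tree_density ?t' = fact ?l"
          using less.hyps[of ?t' "V - U"] fin U kl nkl less.prems
          by (simp add: n_def card_Diff_subset[of U V] subset_Diff_insert)
        ultimately have "real (?N U s) * tree_sigma s * tree_density s = fact ?k"
          "real (?N (V - U) ?t') * tree_sigma ?t' * tree_density ?t' = fact ?l"
          by (metis of_nat_fact of_nat_mult)+
        then show ?thesis
          using M tree_sigma_pos[of s] tree_sigma_pos[of ?t'] tree_density_pos[of s]
            tree_density_pos[of ?t']
          by (simp add: field_simps del: tree_sigma_pos tree_density_pos tree_sigma.simps
              tree_density.simps tree_order.simps)
      qed
      then have "real (\<Sum>U | v \<in> U \<and> U \<subseteq> V - {r} \<and> card U = ?k.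
            ?N U s * ?N (V - U) (Node (M - {#s#}))) =
          (n - 2 choose (?k - 1)) * ((fact ?k / (tree_sigma s * tree_density s)) *
            (fact ?l / (real (tree_sigma ?t') * tree_density ?t')))"
        using card_subsets_containing[OF _ vV kl(1)] cV' less.prems n2
        by (simp add: numeral_2_eq_2)
      also have "(n - 2 choose (?k - 1)) = fact (n - 2) / (fact (?k - 1) * fact (?l - 1))"
        using nkl kl by (subst binomial_fact) (auto simp: numeral_2_eq_2)
      also have "fact (n - 2) / (fact (?k - 1) * fact (?l - 1)) * (fact ?k / (tree_sigma s * tree_density s) *
            (fact ?l / (real (tree_sigma ?t') * tree_density ?t')))
        = fact (n - 2) * (real ?k * ?l) / (real (tree_sigma s * tree_density s) * (real (tree_sigma ?t') * tree_density ?t'))"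
        using kl by (simp add: fact_reduce[of ?k] fact_reduce[of ?l] field_simps
              del: tree_sigma.simps tree_density.simps tree_order.simps)
      also have "\<dots> = fact n / (real (n - 1) * tree_sigma t * tree_density t) * (count M s * tree_order s)"
      proof -
        have 1: "real (tree_sigma t) = count M s * real (tree_sigma s) * tree_sigma ?t'"
          unfolding t M tree_sigma_add by (simp add: algebra_simps)
        have "tree_density t * ?l = n * (tree_density s * tree_density ?t')"
          by (simp add: t M n_def algebra_simps)
        then have "real (tree_density t) * ?l = n * (real (tree_density s) * tree_density ?t')"
          by (metis of_nat_mult)
        then have 2: "real (tree_density t) = n * (real (tree_density s) * tree_density ?t') / ?l"
          using kl by (simp add: field_simps
              del: tree_sigma.simps tree_density.simps tree_order.simps)
        have f: "(fact n :: real) = real n * real (n - 1) * fact (n - 2)"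
        proof -
          obtain k where "n = 2 + k" using le_Suc_ex[OF n2] by blast
          then show ?thesis by (simp add: numeral_2_eq_2 algebra_simps)
        qed
        have alg: "F * (k * l) / ((c * d) * (c' * d')) =
            n' * p * F / (p * (q * c * c') * (n' * (d * d') / l)) * (q * k)"
          if "l > 0" "c > 0" "d > 0" "c' > 0" "d' > 0" "n' > 0" "p > 0" "q > 0"
          for F k l c d c' d' n' p q :: real
          using that by (simp add: field_simps)
        show ?thesis unfolding 1 2 f of_nat_mult
          by (rule alg) (use kl n2 M in \<open>simp_all del: tree_sigma.simps tree_density.simps tree_order.simps\<close>)
      qed
      finally show ?thesis .
    qed
    have "real (?N V t) = (\<Sum>s\<in>set_mset M. fact n / (real (n - 1) * tree_sigma t * tree_density t) *
        (count M s * tree_order s))"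
      unfolding t card_represents_split[OF less.prems(1) ne[unfolded r_def]]
      using * by (simp add: r_def v_def t)
    also have "\<dots> = fact n / (real (n - 1) * tree_sigma t * tree_density t) *
        real (\<Sum>s\<in>set_mset M. count M s * tree_order s)"
      by (simp add: sum_distrib_left)
    also have "(\<Sum>s\<in>set_mset M. count M s * tree_order s) = n - 1"
      by (simp add: n_def t sum_count_mult)
    finally have N: "real (?N V t) = fact n / (real (n - 1) * tree_sigma t * tree_density t) * real (n - 1)" .
    have alg: "F / (p * c * d) * p * c * d = F" if "p > 0" "c > 0" "d > 0" for F p c d :: real
      using that by simp
    have "real (?N V t) * tree_sigma t * tree_density t = fact n"
      unfolding N by (rule alg) (use n2 in simp_all)
    then have "real (?N V t * tree_sigma t * tree_density t) = real (fact n)" by simp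
    then show ?thesis unfolding of_nat_eq_iff n_def .
  qed
qed

lemma tree_alpha_formula:
  "tree_alpha t * tree_sigma t * tree_density t = fact (tree_order t)"
proof -
  define G where "G = (SOME G. represents G t)"
  have G: "represents G t" unfolding G_def using represents_onto by (rule someI_ex)
  have "represents H t" if H: "labelled_tree H" "lt_iso H G" for H
  proof -
    obtain t' where t': "represents H t'" using represents_ex[OF H(1)] by blast
    then have "represents G t'" using represents_iff_iso[OF t'] G H by (auto simp: represents_def)
    then show ?thesis using t' represents_unique[OF G] by simp
  qed
  moreover have "labelled_tree H \<and> lt_iso H G" if "represents H t" for H
    using represents_iff_iso[OF that, of G] G that by (auto simp: represents_def)
  ultimately have "{H. labelled_tree H \<and> fst H = fst G \<and> lt_iso H G} =
      Pair (fst G) ` {E. represents (fst G, E) t}"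
    by force
  then have "tree_alpha t = card {E. represents (fst G, E) t}"
    unfolding tree_alpha_def Let_def G_def[symmetric] by (simp add: card_image inj_on_def)
  moreover have "finite (fst G)" "card (fst G) = tree_order t"
    using G represents_card by (auto simp: represents_def labelled_tree_def)
  ultimately show ?thesis using card_represents by simp
qed

section \<open>Multilinearity and bounds of the total differentials\<close>

lemma total_diff_has_derivative:
  assumes "W \<in> Cb_inf"
  shows "(total_diff W Us has_derivative (\<lambda>U. total_diff W (U # Us) x)) (at x)"
proof -
  have "total_diff W Us differentiable (at x)"
    using assms by (simp add: Cb_inf_def)
  then show ?thesis
    by (simp add: frechet_derivative_works[symmetric])
qed

definition multilinear :: "('a::real_vector list \<Rightarrow> 'b::real_vector) \<Rightarrow> bool" where
  "multilinear D \<longleftrightarrow> (\<forall>us vs. linear (\<lambda>U. D (us @ U # vs)))"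

lemma multilinear_linear: "multilinear D \<Longrightarrow> linear (\<lambda>U. D (us @ U # vs))"
  by (simp add: multilinear_def)

text \<open>
  In the last added argument linearity is that of a Frechet derivative; in the other ones it is
  inherited, because differentiation is linear in the function differentiated.
\<close>

lemma multilinear_total_diff:
  assumes W: "W \<in> Cb_inf"
  shows "multilinear (\<lambda>Us. total_diff W Us x)"
  unfolding multilinear_def
proof (intro allI)
  fix us vs show "linear (\<lambda>U. total_diff W (us @ U # vs) x)"
  proof (induction us arbitrary: x)
    case Nil
    show ?case
      using has_derivative_linear[OF total_diff_has_derivative[OF W]] by simp
  next
    case (Cons u us)
    let ?f = "\<lambda>U. total_diff W (us @ U # vs)"
    have add: "?f (U + V) = (\<lambda>y. ?f U y + ?f V y)" and scale: "?f (c *\<^sub>R U) = (\<lambda>y. c *\<^sub>R ?f U y)"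
      for U V c by (simp_all add: fun_eq_iff linear_add[OF Cons.IH] linear_scale[OF Cons.IH])
    note d = total_diff_has_derivative[OF W]
    have D1: "((\<lambda>y. ?f U y + ?f V y) has_derivative
        (\<lambda>u. total_diff W (u # us @ U # vs) x + total_diff W (u # us @ V # vs) x)) (at x)" for U V
      by (intro has_derivative_add d)
    have 1: "total_diff W (u # us @ (U + V) # vs) x =
        total_diff W (u # us @ U # vs) x + total_diff W (u # us @ V # vs) x" for U V
      by (simp add: add frechet_derivative_at[OF D1, symmetric])
    have D2: "((\<lambda>y. c *\<^sub>R ?f U y) has_derivative (\<lambda>u. c *\<^sub>R total_diff W (u # us @ U # vs) x)) (at x)"
      for U c by (intro has_derivative_scaleR_right d)
    have 2: "total_diff W (u # us @ (c *\<^sub>R U) # vs) x = c *\<^sub>R total_diff W (u # us @ U # vs) x"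
      for U c by (simp add: scale frechet_derivative_at[OF D2, symmetric])
    show ?case by (rule linearI) (use 1 2 in simp_all)
  qed
qed

lemma multilinear_normalize:
  fixes D :: "'a::real_normed_vector list \<Rightarrow> 'b::real_vector"
  assumes D: "multilinear D"
  shows "D (us @ Us) = prod_list (map norm Us) *\<^sub>R D (us @ map sgn Us)"
proof (induction Us arbitrary: us)
  case (Cons U Us)
  have U: "U = norm U *\<^sub>R sgn U"
    by (cases "U = 0") (simp_all add: sgn_div_norm)
  have "D (us @ U # Us) = D (us @ (norm U *\<^sub>R sgn U) # Us)"
    by (rule arg_cong[OF U])
  also have "\<dots> = norm U *\<^sub>R D (us @ sgn U # Us)"
    by (rule linear_scale[OF multilinear_linear[OF D]])
  finally show ?case using Cons.IH[of "us @ [sgn U]"] by simp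
qed simp

lemma multilinear_sum_expand:
  assumes D: "multilinear D" and "finite S"
  shows "D (us @ replicate l (\<Sum>t\<in>S. c t *\<^sub>R F t)) =
    (\<Sum>ts | set ts \<subseteq> S \<and> length ts = l. prod_list (map c ts) *\<^sub>R D (us @ map F ts))"
proof (induction l arbitrary: us)
  case 0
  have "{ts. set ts \<subseteq> S \<and> length ts = 0} = {[]}" by auto
  then show ?case by simp
next
  case (Suc l)
  let ?P = "\<Sum>t\<in>S. c t *\<^sub>R F t" and ?L = "\<lambda>l. {ts. set ts \<subseteq> S \<and> length ts = l}"
  have lin: "linear (\<lambda>U. D (us @ U # vs))" for vs
    by (rule multilinear_linear[OF D])
  have "D (us @ replicate (Suc l) ?P) = (\<Sum>t\<in>S. c t *\<^sub>R D ((us @ [F t]) @ replicate l ?P))"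
    using linear_sum[OF lin, of _ S] linear_scale[OF lin] by simp
  also have "\<dots> = (\<Sum>t\<in>S. \<Sum>ts\<in>?L l. prod_list (map c (t # ts)) *\<^sub>R D (us @ map F (t # ts)))"
    unfolding Suc.IH by (simp add: scaleR_sum_right)
  also have "\<dots> = (\<Sum>(ts, t)\<in>?L l \<times> S. prod_list (map c (t # ts)) *\<^sub>R D (us @ map F (t # ts)))"
    by (subst sum.swap) (simp add: sum.cartesian_product)
  also have "\<dots> = (\<Sum>ts\<in>?L (Suc l). prod_list (map c ts) *\<^sub>R D (us @ map F ts))"
    unfolding lists_length_Suc_eq
    by (subst sum.reindex) (auto simp: inj_on_def intro!: sum.cong)
  finally show ?case .
qed

text \<open>
  Exchange \<open>h\<close> for \<open>p\<close> one argument at a time; each exchange costs a factor \<open>\<delta>\<close>.  Asking for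
  \<open>1 \<le> R\<close> allows the crude exponent \<open>l\<close> in place of \<open>l - 1\<close>.  The prefix \<open>us\<close> holds the arguments already
  exchanged.
\<close>

lemma multilinear_replicate_diff_le:
  fixes D :: "'a::real_normed_vector list \<Rightarrow> 'b::real_normed_vector"
  assumes D: "multilinear D"
    and K: "\<And>Us. length Us = length us + l \<Longrightarrow> norm (D Us) \<le> K * prod_list (map norm Us)"
    and R: "norm h \<le> R" "norm p \<le> R" "1 \<le> R" and \<delta>: "norm (h - p) \<le> \<delta>" and "0 \<le> K"
  shows "norm (D (us @ replicate l h) - D (us @ replicate l p)) \<le>
     K * prod_list (map norm us) * (l * \<delta> * R ^ l)"
  using K
proof (induction l arbitrary: us)
  case (Suc l)
  have lin: "linear (\<lambda>U. D (us @ U # vs))" for vs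
    by (rule multilinear_linear[OF D])
  have pos: "0 \<le> prod_list (map norm us)"
    by (rule prod_list_nonneg) auto
  have \<delta>0: "0 \<le> \<delta>" using \<delta> norm_ge_zero order_trans by blast
  let ?d = "D (us @ (h - p) # replicate l h)"
  have "norm ?d \<le> K * prod_list (map norm (us @ (h - p) # replicate l h))"
    by (rule Suc.prems) simp
  also have "\<dots> = K * prod_list (map norm us) * (norm (h - p) * norm h ^ l)"
    by simp
  also have "\<dots> \<le> K * prod_list (map norm us) * (\<delta> * R ^ Suc l)"
  proof (intro mult_left_mono mult_mono)
    have "norm h ^ l \<le> R ^ l" using R by (intro power_mono) auto
    also have "\<dots> \<le> R ^ Suc l" using R by (intro power_increasing) auto
    finally show "norm h ^ l \<le> R ^ Suc l" .
  qed (use \<delta> \<delta>0 pos \<open>0 \<le> K\<close> in auto)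
  finally have 1: "norm ?d \<le> K * prod_list (map norm us) * (\<delta> * R ^ Suc l)" .
  have "norm (D ((us @ [p]) @ replicate l h) - D ((us @ [p]) @ replicate l p)) \<le>
      K * prod_list (map norm (us @ [p])) * (l * \<delta> * R ^ l)"
    by (rule Suc.IH) (use Suc.prems in simp)
  also have "\<dots> = K * prod_list (map norm us) * (l * \<delta> * (norm p * R ^ l))"
    by simp
  also have "\<dots> \<le> K * prod_list (map norm us) * (l * \<delta> * R ^ Suc l)"
    using R \<delta>0 pos \<open>0 \<le> K\<close> by (intro mult_left_mono) (auto intro!: mult_right_mono)
  finally have 2: "norm (D (us @ p # replicate l h) - D (us @ p # replicate l p)) \<le> \<dots>"
    by simp
  have "D (us @ h # replicate l h) = ?d + D (us @ p # replicate l h)"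
    using linear_diff[OF lin] by simp
  then have "norm (D (us @ replicate (Suc l) h) - D (us @ replicate (Suc l) p)) \<le>
      norm ?d + norm (D (us @ p # replicate l h) - D (us @ p # replicate l p))"
    by (metis (no_types, lifting) add_diff_eq norm_triangle_ineq replicate_Suc)
  also have "\<dots> \<le> K * prod_list (map norm us) * (\<delta> * R ^ Suc l) +
      K * prod_list (map norm us) * (l * \<delta> * R ^ Suc l)"
    by (rule add_mono[OF 1 2])
  also have "\<dots> = K * prod_list (map norm us) * (Suc l * \<delta> * R ^ Suc l)"
    by (simp add: algebra_simps)
  finally show ?case .
qed simp

lemma diff_norms_le_Sup:
  assumes "W \<in> Cb_inf" "Us \<in> unit_args i"
  shows "norm (total_diff W Us x) \<le> Sup (diff_norms W i)"
proof (rule cSup_upper)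
  show "norm (total_diff W Us x) \<in> diff_norms W i"
    using assms by (auto simp: diff_norms_def)
  show "bdd_above (diff_norms W i)"
    using assms by (auto simp: Cb_inf_def intro: bounded_imp_bdd_above)
qed

lemma Sup_diff_norms_nonneg:
  fixes W :: "real ^ 'n \<Rightarrow> real ^ 'n"
  assumes "W \<in> Cb_inf"
  shows "0 \<le> Sup (diff_norms W i)"
proof -
  have "replicate i (axis undefined 1) \<in> (unit_args i :: (real ^ 'n) list set)"
    by (simp add: unit_args_def)
  from order_trans[OF norm_ge_zero diff_norms_le_Sup[OF assms this]] show ?thesis .
qed

lemma C_norm_nonneg: "W \<in> Cb_inf \<Longrightarrow> 0 \<le> C_norm n W"
  unfolding C_norm_def by (intro sum_nonneg Sup_diff_norms_nonneg)

text \<open>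
  The seminorms are suprema over unit vectors; homogeneity in every argument extends the bound to
  arbitrary ones.
\<close>

lemma norm_total_diff_le:
  assumes W: "W \<in> Cb_inf" and len: "length Us \<le> n"
  shows "norm (total_diff W Us x) \<le> C_norm n W * prod_list (map norm Us)"
proof (cases "0 \<in> set Us")
  case True
  then have "prod_list (map norm Us) = 0" by (auto simp: prod_list_zero_iff)
  then show ?thesis
    using multilinear_normalize[OF multilinear_total_diff[OF W, of x], of "[]" Us] by simp
next
  case False
  then have "map sgn Us \<in> unit_args (length Us)"
    by (auto simp: unit_args_def norm_sgn)
  then have "norm (total_diff W (map sgn Us) x) \<le> Sup (diff_norms W (length Us))"
    by (rule diff_norms_le_Sup[OF W])
  also have "\<dots> \<le> C_norm n W"
    unfolding C_norm_def using len
    by (intro member_le_sum) (auto intro: Sup_diff_norms_nonneg[OF W])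
  finally have "norm (total_diff W (map sgn Us) x) \<le> C_norm n W" .
  moreover have "0 \<le> prod_list (map norm Us)" by (rule prod_list_nonneg) auto
  ultimately show ?thesis
    using multilinear_normalize[OF multilinear_total_diff[OF W, of x], of "[]" Us]
    by (simp add: mult.commute[of "C_norm n W"] mult_left_mono)
qed

lemma norm_le_C_norm: "W \<in> Cb_inf \<Longrightarrow> norm (W x) \<le> C_norm n W"
  using norm_total_diff_le[of W "[]" n x] by simp

lemma Cb_inf_lipschitz:
  assumes W: "W \<in> Cb_inf"
  shows "norm (W x - W y) \<le> C_norm 1 W * norm (x - y)"
proof (rule differentiable_bound[of UNIV W "\<lambda>z U. total_diff W [U] z"])
  show "(W has_derivative (\<lambda>U. total_diff W [U] z)) (at z within UNIV)" for z
    using total_diff_has_derivative[OF W, of "[]"] by simp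
  show "onorm (\<lambda>U. total_diff W [U] z) \<le> C_norm 1 W" for z
    by (rule onorm_le) (use norm_total_diff_le[OF W, of "[_]" 1] in simp)
qed auto

text \<open>
  The one-dimensional Taylor formula with integral remainder, along the segment from \<open>x\<close> to \<open>x + h\<close>:
  each differentiation of \<open>t \<mapsto> W (x + t h)\<close> puts one more \<open>h\<close> in front of the argument list.
\<close>

lemma Taylor_total_diff:
  assumes W: "W \<in> Cb_inf" and p: "p > 0"
  shows "norm (W (x + h) - (\<Sum>i<p. (1 / fact i) *\<^sub>R total_diff W (replicate i h) x)) \<le>
    C_norm p W * norm h ^ p"
proof -
  define Df where "Df i t = total_diff W (replicate i h) (x + t *\<^sub>R h)" for i t
  have D: "(Df i has_vector_derivative Df (Suc i) t) (at t within {0..1})" for i t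
  proof -
    have "((\<lambda>t. x + t *\<^sub>R h) has_derivative (\<lambda>s. s *\<^sub>R h)) (at t within {0..1})"
      by (auto intro!: derivative_eq_intros)
    from has_derivative_compose[OF this total_diff_has_derivative[OF W, of "replicate i h"]]
    have "(Df i has_derivative (\<lambda>s. total_diff W ((s *\<^sub>R h) # replicate i h) (x + t *\<^sub>R h)))
        (at t within {0..1})"
      by (simp add: Df_def[abs_def])
    moreover have "total_diff W ((s *\<^sub>R h) # replicate i h) y = s *\<^sub>R total_diff W (h # replicate i h) y"
      for s y
      using linear_scale[OF multilinear_linear[OF multilinear_total_diff[OF W, of y]], of "[]"]
      by simp
    ultimately show ?thesis by (simp add: has_vector_derivative_def Df_def)
  qed
  have "((\<lambda>t. ((1 - t) ^ (p - 1) / fact (p - 1)) *\<^sub>R Df p t) has_integral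
      Df 0 1 - (\<Sum>i<p. ((1 - 0) ^ i / fact i) *\<^sub>R Df i 0)) {0..1}"
    by (rule Taylor_has_integral[OF p refl]) (use D in auto)
  moreover have "norm (((1 - t) ^ (p - 1) / fact (p - 1)) *\<^sub>R Df p t) \<le> C_norm p W * norm h ^ p"
    if "t \<in> {0..1}" for t
  proof -
    have "(1 - t) ^ (p - 1) \<le> 1" using that by (intro power_le_one) auto
    then have "\<bar>(1 - t) ^ (p - 1) / fact (p - 1)\<bar> \<le> 1"
      using that by (simp add: divide_le_eq) (meson fact_ge_1 order_trans)
    moreover have "norm (Df p t) \<le> C_norm p W * norm h ^ p"
      unfolding Df_def using norm_total_diff_le[OF W, of "replicate p h" p] by simp
    ultimately show ?thesis
      using mult_mono[of "\<bar>(1 - t) ^ (p - 1) / fact (p - 1)\<bar>" 1 "norm (Df p t)"] by simp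
  qed
  ultimately have "norm (Df 0 1 - (\<Sum>i<p. ((1 - 0) ^ i / fact i) *\<^sub>R Df i 0)) \<le>
      C_norm p W * norm h ^ p * measure lborel {0..1::real}"
    by (intro has_integral_bound_real[where S = "{}"]) (auto intro!: mult_nonneg_nonneg C_norm_nonneg W)
  then show ?thesis by (simp add: Df_def)
qed

section \<open>Existence and uniqueness of flow lines\<close>

definition flow_line :: "('a::real_normed_vector \<Rightarrow> 'a) \<Rightarrow> (real \<Rightarrow> 'a) \<Rightarrow> bool" where
  "flow_line W z \<longleftrightarrow> (\<forall>t\<in>{0..1}. (z has_vector_derivative W (z t)) (at t within {0..1}))"

text \<open>
  Gronwall's argument: the squared distance of two solutions, damped by \<open>exp (- 2 L t)\<close>, has a
  nonpositive derivative.
\<close>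

lemma flow_line_unique:
  fixes W :: "'a::real_inner \<Rightarrow> 'a"
  assumes lip: "\<And>x y. norm (W x - W y) \<le> L * norm (x - y)"
    and z: "flow_line W z" and w: "flow_line W w" and 0: "z 0 = w 0" and t: "t \<in> {0..1}"
  shows "z t = w t"
proof (cases "t = 0")
  case False
  define f where "f s = exp (- (2 * L * s)) * ((z s - w s) \<bullet> (z s - w s))" for s
  define f' where "f' s = exp (- (2 * L * s)) * (2 * ((z s - w s) \<bullet> (W (z s) - W (w s))))
    - 2 * L * exp (- (2 * L * s)) * ((z s - w s) \<bullet> (z s - w s))" for s
  have D: "(f has_real_derivative f' s) (at s within {0..1})" if s: "s \<in> {0..1}" for s
  proof -
    have d: "((\<lambda>s. z s - w s) has_vector_derivative W (z s) - W (w s)) (at s within {0..1})"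
      using z w s by (auto simp: flow_line_def intro: has_vector_derivative_diff)
    have n: "((\<lambda>s. (z s - w s) \<bullet> (z s - w s)) has_derivative
        (\<lambda>h. (z s - w s) \<bullet> (h *\<^sub>R (W (z s) - W (w s))) + (h *\<^sub>R (W (z s) - W (w s))) \<bullet> (z s - w s)))
        (at s within {0..1})"
      by (rule has_derivative_inner) (use d in \<open>simp_all add: has_vector_derivative_def\<close>)
    have i: "((\<lambda>s. (z s - w s) \<bullet> (z s - w s)) has_real_derivative
        2 * ((z s - w s) \<bullet> (W (z s) - W (w s)))) (at s within {0..1})"
      unfolding has_field_derivative_def
      by (rule has_derivative_eq_rhs[OF n]) (simp add: fun_eq_iff inner_commute)
    have e: "((\<lambda>s. exp (- (2 * L * s))) has_real_derivative - 2 * L * exp (- (2 * L * s))) (at s within {0..1})"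
      by (auto intro!: derivative_eq_intros)
    show ?thesis unfolding f_def[abs_def] f'_def
      by (rule DERIV_cong[OF DERIV_mult[OF e i]]) simp
  qed
  have neg: "f' s \<le> 0" for s
  proof -
    have "(z s - w s) \<bullet> (W (z s) - W (w s)) \<le> norm (z s - w s) * norm (W (z s) - W (w s))"
      by (rule norm_cauchy_schwarz)
    also have "\<dots> \<le> norm (z s - w s) * (L * norm (z s - w s))"
      by (intro mult_left_mono lip) simp
    also have "\<dots> = L * ((z s - w s) \<bullet> (z s - w s))"
      by (simp add: dot_square_norm power2_eq_square)
    finally have "exp (- (2 * L * s)) * (2 * ((z s - w s) \<bullet> (W (z s) - W (w s)))) \<le>
        exp (- (2 * L * s)) * (2 * (L * ((z s - w s) \<bullet> (z s - w s))))"
      by (intro mult_left_mono) auto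
    then show ?thesis unfolding f'_def by (simp add: algebra_simps)
  qed
  have "f t \<le> f 0"
  proof (rule DERIV_nonpos_imp_decreasing_open[of 0 t f])
    show "0 \<le> t" using t by simp
  next
    show "\<exists>y. (f has_real_derivative y) (at s) \<and> y \<le> 0" if "0 < s" "s < t" for s
      using D[of s] neg[of s] that t by (auto simp: at_within_Icc_at)
  next
    have "continuous_on {0..1} f"
      using D by (meson DERIV_continuous continuous_on_eq_continuous_within)
    then show "continuous_on {0..t} f" by (rule continuous_on_subset) (use t in auto)
  qed
  then have "f t \<le> 0" by (simp add: f_def 0)
  then have "(z t - w t) \<bullet> (z t - w t) \<le> 0" by (simp add: f_def mult_le_0_iff)
  then show ?thesis by (metis eq_iff_diff_eq_0 inner_ge_zero inner_eq_zero_iff order_antisym)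
qed (use 0 in simp)

text \<open>
  Picard's argument on the whole unit interval at once.  The solution is sought in the form
  \<open>z t = x + exp (\<mu> t) u t\<close> with \<open>u\<close> bounded and continuous; in terms of \<open>u\<close> the Picard operator is a
  contraction with factor \<open>L / \<mu>\<close>, which is below \<open>1\<close> for \<open>\<mu> = L + 1\<close>.
\<close>

lemma flow_line_exists:
  fixes W :: "'a::euclidean_space \<Rightarrow> 'a"
  assumes lip: "\<And>x y. norm (W x - W y) \<le> L * norm (x - y)" and L: "0 \<le> L"
    and bd: "\<And>x. norm (W x) \<le> B"
  shows "\<exists>z. flow_line W z \<and> z 0 = x"
proof -
  define \<mu> where "\<mu> = L + 1"
  have \<mu>: "\<mu> > 0" using L by (simp add: \<mu>_def)
  have contW: "continuous_on S W" for S
    using lip by (intro lipschitz_on_continuous_on[of L] lipschitz_onI) (auto simp: dist_norm L)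
  (* The Banach space consists of functions on the whole real line; times outside the unit interval
     are moved to its nearest end point. *)
  define clip where "clip t = max 0 (min 1 t)" for t :: real
  have clip: "clip t \<in> {0..1}" "t \<in> {0..1} \<Longrightarrow> clip t = t" for t by (auto simp: clip_def)
  define z where "z u s = x + exp (\<mu> * s) *\<^sub>R u s" for u :: "real \<Rightarrow> 'a" and s
  define I where "I u c = integral {0..c} (\<lambda>s. W (z u s))" for u c
  define T where "T u t = exp (- (\<mu> * clip t)) *\<^sub>R I (apply_bcontfun u) (clip t)" for u t
  have contz: "continuous_on S (\<lambda>s. W (z (apply_bcontfun u) s))" for u S
    unfolding z_def
    by (intro continuous_on_compose2[OF contW[of UNIV]] continuous_intros) auto
  have int: "(\<lambda>s. W (z (apply_bcontfun u) s)) integrable_on {a..b}" for u a b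
    by (rule integrable_continuous_interval[OF contz])
  have Tb: "T u \<in> bcontfun" for u
  proof (rule bcontfun_normI)
    have "continuous_on {0..1} (I (apply_bcontfun u))"
      unfolding I_def by (rule indefinite_integral_continuous_1[OF int])
    then have "continuous_on UNIV (\<lambda>t. I (apply_bcontfun u) (clip t))"
      by (rule continuous_on_compose2) (use clip in \<open>auto simp: clip_def intro!: continuous_intros\<close>)
    moreover have "continuous_on UNIV clip"
      unfolding clip_def by (intro continuous_intros)
    ultimately show "continuous_on UNIV (T u)"
      unfolding T_def by (intro continuous_intros)
    show "norm (T u t) \<le> B" for t
    proof -
      have B: "0 \<le> B" using bd norm_ge_zero order_trans by blast
      have "norm (I (apply_bcontfun u) (clip t)) \<le> B * (clip t - 0)"
        unfolding I_def using clip by (intro integral_bound contz bd) auto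
      also have "\<dots> \<le> B" using clip[of t] B by (simp add: mult_left_le)
      finally have "norm (I (apply_bcontfun u) (clip t)) \<le> B" .
      moreover have "exp (- (\<mu> * clip t)) \<le> 1" using clip[of t] \<mu> by simp
      ultimately show ?thesis
        using mult_mono[of "exp (- (\<mu> * clip t))" 1 "norm (I (apply_bcontfun u) (clip t))" B]
        by (simp add: T_def)
    qed
  qed
  have contr: "dist (Bcontfun (T u)) (Bcontfun (T v)) \<le> L / \<mu> * dist u v" for u v
  proof (rule dist_bound)
    fix t
    define c where "c = clip t"
    have c: "0 \<le> c" using clip[of t] by (simp add: c_def)
    have e: "((\<lambda>s. L * dist u v * exp (\<mu> * s)) has_integral
        L * dist u v * exp (\<mu> * c) / \<mu> - L * dist u v * exp (\<mu> * 0) / \<mu>) {0..c}"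
      by (rule fundamental_theorem_of_calculus[OF c])
        (use \<mu> in \<open>auto intro!: derivative_eq_intros simp: has_real_derivative_iff_has_vector_derivative[symmetric]\<close>)
    have "norm (I (apply_bcontfun u) c - I (apply_bcontfun v) c) \<le>
        integral {0..c} (\<lambda>s. L * dist u v * exp (\<mu> * s))"
      unfolding I_def integral_diff[OF int int, symmetric]
    proof (rule integral_norm_bound_integral)
      show "(\<lambda>s. W (z (apply_bcontfun u) s) - W (z (apply_bcontfun v) s)) integrable_on {0..c}"
        by (intro integrable_diff int)
      show "(\<lambda>s. L * dist u v * exp (\<mu> * s)) integrable_on {0..c}" using e by blast
      fix s
      have "norm (W (z (apply_bcontfun u) s) - W (z (apply_bcontfun v) s)) \<le>
          L * norm (z (apply_bcontfun u) s - z (apply_bcontfun v) s)" by (rule lip)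
      also have "norm (z (apply_bcontfun u) s - z (apply_bcontfun v) s) = exp (\<mu> * s) * dist (u s) (v s)"
        by (simp add: z_def dist_norm scaleR_diff_right[symmetric])
      also have "L * (exp (\<mu> * s) * dist (u s) (v s)) \<le> L * (exp (\<mu> * s) * dist u v)"
        using L by (intro mult_left_mono dist_bounded) auto
      finally show "norm (W (z (apply_bcontfun u) s) - W (z (apply_bcontfun v) s)) \<le> L * dist u v * exp (\<mu> * s)"
        by (simp add: mult_ac)
    qed
    also have "\<dots> = L * dist u v * exp (\<mu> * c) / \<mu> - L * dist u v * exp (\<mu> * 0) / \<mu>"
      by (rule integral_unique[OF e])
    also have "\<dots> \<le> L / \<mu> * dist u v * exp (\<mu> * c)"
      using L \<mu> by (simp add: field_simps)
    finally have "exp (- (\<mu> * c)) * norm (I (apply_bcontfun u) c - I (apply_bcontfun v) c) \<le>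
        exp (- (\<mu> * c)) * (L / \<mu> * dist u v * exp (\<mu> * c))"
      by (rule mult_left_mono) simp
    also have "\<dots> = L / \<mu> * dist u v"
      by (simp add: exp_minus field_simps)
    finally show "dist (Bcontfun (T u) t) (Bcontfun (T v) t) \<le> L / \<mu> * dist u v"
      by (simp add: Bcontfun_inverse Tb T_def c_def dist_norm scaleR_diff_right[symmetric])
  qed
  have "\<exists>!u. Bcontfun (T u) = u"
    by (rule banach_fix_type[of "L / \<mu>"]) (use L contr in \<open>auto simp: \<mu>_def\<close>)
  then obtain u where "Bcontfun (T u) = u" by blast
  then have u: "apply_bcontfun u t = T u t" for t by (metis Bcontfun_inverse Tb)
  have zI: "x + I (apply_bcontfun u) t = z (apply_bcontfun u) t" if "t \<in> {0..1}" for t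
    by (simp add: z_def u T_def clip(2)[OF that] exp_minus)
  have "((\<lambda>t. x + I (apply_bcontfun u) t) has_vector_derivative W (z (apply_bcontfun u) t)) (at t within {0..1})"
    if "t \<in> {0..1}" for t
  proof -
    have "(I (apply_bcontfun u) has_vector_derivative W (z (apply_bcontfun u) t)) (at t within {0..1})"
      unfolding I_def[abs_def] by (rule integral_has_vector_derivative[OF contz that])
    then show ?thesis by (auto intro!: derivative_eq_intros)
  qed
  then have "flow_line W (z (apply_bcontfun u))"
    unfolding flow_line_def by (intro ballI has_vector_derivative_transform[OF _ zI[symmetric]]) auto
  moreover have "z (apply_bcontfun u) 0 = x" using zI[of 0] by (simp add: I_def)
  ultimately show ?thesis by blast
qed

lemma exp_flow_flow_line:
  assumes W: "W \<in> Cb_inf"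
  obtains z where "flow_line W z" "z 0 = x" "exp_flow W x = z 1"
proof -
  note lip = Cb_inf_lipschitz[OF W]
  obtain z where z: "flow_line W z" "z 0 = x"
    using flow_line_exists[OF lip C_norm_nonneg[OF W] norm_le_C_norm[OF W]] by blast
  have "exp_flow W x = z 1"
    unfolding exp_flow_def flow_line_def[symmetric]
  proof (rule the_equality)
    show "\<exists>z'. z' 0 = x \<and> z' 1 = z 1 \<and> flow_line W z'" using z by blast
    fix y assume "\<exists>z'. z' 0 = x \<and> z' 1 = y \<and> flow_line W z'"
    then show "y = z 1" using flow_line_unique[OF lip _ z(1), of _ 1] z(2) by auto
  qed
  then show thesis using that z by blast
qed

section \<open>B-series over ordered trees\<close>

text \<open>
  The arguments of a total differential form a list, so the series below are indexed by trees with
  ordered branches.  Several of them share the same shape.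
\<close>

datatype otree = ONode "otree list"

fun oshape :: "otree \<Rightarrow> rtree" where
  "oshape (ONode ts) = Node (mset (map oshape ts))"

abbreviation oorder :: "otree \<Rightarrow> nat" where
  "oorder t \<equiv> tree_order (oshape t)"

lemma oorder_ONode: "oorder (ONode ts) = Suc (sum_list (map oorder ts))"
  by (simp add: multiset.map_comp comp_def flip: sum_mset_sum_list)

text \<open>
  The Taylor factor \<open>1 / l!\<close> of every vertex with \<open>l\<close> branches.  Summed over the ordered trees of one
  shape these weights give \<open>1 / \<sigma>\<close> of that shape.
\<close>

fun oweight :: "otree \<Rightarrow> real" where
  "oweight (ONode ts) = prod_list (map oweight ts) / fact (length ts)"

text \<open>
  The elementary differentials of \<open>W\<close> at \<open>y\<close>.
\<close>

fun elem_diff :: "('a::real_normed_vector \<Rightarrow> 'a) \<Rightarrow> 'a \<Rightarrow> otree \<Rightarrow> 'a" where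
  "elem_diff W y (ONode ts) = total_diff W (map (elem_diff W y) ts) y"

text \<open>
  If \<open>z\<close> gives the coefficients of the series of an increment \<open>h\<close>, then this gives those of the series
  of \<open>W (y + h)\<close>.
\<close>

fun branches :: "(rtree \<Rightarrow> real) \<Rightarrow> rtree \<Rightarrow> real" where
  "branches z (Node M) = \<Prod>\<^sub># (image_mset z M)"

definition otrees :: "nat \<Rightarrow> otree set" where
  "otrees q = {t. oorder t \<le> q}"

text \<open>
  A B-series truncated at order \<open>q\<close>.
\<close>

definition bseries :: "nat \<Rightarrow> (rtree \<Rightarrow> real) \<Rightarrow> ('a::real_normed_vector \<Rightarrow> 'a) \<Rightarrow> 'a \<Rightarrow> 'a" where
  "bseries q z W y = (\<Sum>t\<in>otrees q. (oweight t * z (oshape t)) *\<^sub>R elem_diff W y t)"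

lemma otrees_0 [simp]: "otrees 0 = {}"
  using tree_order_pos by (auto simp: otrees_def)

lemma length_le_sum_oorder: "length ts \<le> sum_list (map oorder ts)"
proof (induction ts)
  case (Cons t ts)
  then show ?case
    using tree_order_pos[of "oshape t"] unfolding list.map sum_list.Cons list.size by linarith
qed simp

lemma oorder_le_sum: "t \<in> set ts \<Longrightarrow> oorder t \<le> sum_list (map oorder ts)"
  by (simp add: member_le_sum_list)

lemma otrees_Suc: "otrees (Suc q) = ONode ` {ts. sum_list (map oorder ts) \<le> q}"
proof (intro equalityI subsetI)
  fix t assume t: "t \<in> otrees (Suc q)"
  obtain ts where "t = ONode ts" by (cases t)
  then show "t \<in> ONode ` {ts. sum_list (map oorder ts) \<le> q}"
    using t by (auto simp: otrees_def oorder_ONode simp del: oshape.simps)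
qed (auto simp: otrees_def oorder_ONode simp del: oshape.simps)

lemma finite_otrees [simp]: "finite (otrees q)"
proof (induction q)
  case (Suc q)
  have "{ts. sum_list (map oorder ts) \<le> q} \<subseteq> {ts. set ts \<subseteq> otrees q \<and> length ts \<le> q}"
    using length_le_sum_oorder oorder_le_sum by (auto simp: otrees_def intro: order_trans)
  then have "finite {ts. sum_list (map oorder ts) \<le> q}"
    by (rule finite_subset) (rule finite_lists_length_le[OF Suc.IH])
  then show ?case by (simp add: otrees_Suc)
qed simp

lemma oweight_bounds: "0 \<le> oweight t \<and> oweight t \<le> 1"
proof (induction t)
  case (ONode ts)
  then have "0 \<le> prod_list (map oweight ts) \<and> prod_list (map oweight ts) \<le> 1"
    by (induction ts) (auto intro: mult_le_one)
  then show ?case by (simp add: divide_le_eq) (meson fact_ge_1 order_trans)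
qed

lemma C_norm_mono: "W \<in> Cb_inf \<Longrightarrow> k \<le> n \<Longrightarrow> C_norm k W \<le> C_norm n W"
  unfolding C_norm_def by (intro sum_mono2) (auto intro: Sup_diff_norms_nonneg)

text \<open>
  Every vertex contributes one factor \<open>W\<close> or one of its differentials.  The order may exceed \<open>n\<close> by one
  because a tree with \<open>n + 1\<close> vertices has no vertex with more than \<open>n\<close> branches.
\<close>

lemma norm_elem_diff_le:
  assumes W: "W \<in> Cb_inf"
  shows "oorder t \<le> Suc n \<Longrightarrow> norm (elem_diff W y t) \<le> C_norm n W ^ oorder t"
proof (induction t)
  case (ONode ts)
  let ?\<rho> = "C_norm n W"
  have \<rho>: "0 \<le> ?\<rho>" by (rule C_norm_nonneg[OF W])
  have sum: "sum_list (map oorder ts) \<le> n"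
    using ONode.prems by (simp add: oorder_ONode del: oshape.simps)
  have each: "norm (elem_diff W y t) \<le> ?\<rho> ^ oorder t" if "t \<in> set ts" for t
    using ONode.IH[OF that] oorder_le_sum[OF that] sum by simp
  then have prod: "prod_list (map norm (map (elem_diff W y) ts)) \<le> ?\<rho> ^ sum_list (map oorder ts)"
    by (induction ts) (auto simp: power_add intro!: mult_mono prod_list_nonneg zero_le_power \<rho>)
  have "norm (elem_diff W y (ONode ts)) \<le> ?\<rho> * prod_list (map norm (map (elem_diff W y) ts))"
    using norm_total_diff_le[OF W, of "map (elem_diff W y) ts" n y]
      length_le_sum_oorder[of ts] sum by simp
  also have "\<dots> \<le> ?\<rho> * ?\<rho> ^ sum_list (map oorder ts)"
    by (rule mult_left_mono[OF prod \<rho>])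
  finally show ?case by (simp add: oorder_ONode del: oshape.simps)
qed

text \<open>
  The main step: if \<open>h\<close> agrees with the series with coefficients \<open>z\<close> up to order \<open>q\<close>, then \<open>W (y + h)\<close>
  agrees with the series with coefficients \<open>branches z\<close> up to order \<open>q + 1\<close>.  The order goes up by one
  because \<open>W\<close> and all its differentials are of the size of the seminorm \<open>\<rho>\<close> of \<open>W\<close>.  The constant is
  explicit to make visible that it depends neither on \<open>W\<close> nor on the base point; its three summands come
  from the Taylor remainder, from replacing \<open>h\<close> by its series, and from the trees of too high order which
  appear when the multilinear terms are expanded.
\<close>

lemma bseries_compose:
  fixes W :: "real ^ 'n \<Rightarrow> real ^ 'n" and B C Z :: real
  assumes W: "W \<in> Cb_inf" and q: "q < n" and \<rho>1: "C_norm n W \<le> 1"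
    and B: "0 \<le> B" "norm h \<le> B * C_norm n W"
    and C: "0 \<le> C" "norm (h - bseries q z W y) \<le> C * C_norm n W ^ Suc q"
    and Z: "1 \<le> Z" "\<And>t. tree_order t \<le> q \<Longrightarrow> \<bar>z t\<bar> \<le> Z"
  shows "norm (W (y + h) - bseries (Suc q) (branches z) W y) \<le>
     (B ^ Suc q + (\<Sum>l<Suc q. l * C * (1 + B + C) ^ l) +
        card {ts. set ts \<subseteq> otrees q \<and> length ts \<le> q} * Z ^ q) * C_norm n W ^ Suc (Suc q)"
proof -
  define \<rho> where "\<rho> = C_norm n W"
  define P where "P = bseries q z W y"
  define R where "R = 1 + B + C"
  define L where "L = {ts. set ts \<subseteq> otrees q \<and> length ts \<le> q}"
  define summand where "summand t = (oweight t * branches z (oshape t)) *\<^sub>R elem_diff W y t" for t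
  have \<rho>: "0 \<le> \<rho>" "\<rho> \<le> 1" using C_norm_nonneg[OF W] \<rho>1 by (auto simp: \<rho>_def)
  have finL: "finite L" unfolding L_def by (rule finite_lists_length_le) simp
  have hR: "norm h \<le> R"
  proof -
    have "B * \<rho> \<le> B" using B \<rho> by (simp add: mult_left_le)
    then show ?thesis using B C by (simp add: R_def \<rho>_def)
  qed
  have PR: "norm P \<le> R"
  proof -
    have "norm P \<le> norm h + norm (h - P)" by (metis norm_minus_commute norm_triangle_sub)
    moreover have "B * \<rho> \<le> B" using B \<rho> by (simp add: mult_left_le)
    moreover have "C * \<rho> ^ Suc q \<le> C" using C \<rho> by (intro mult_left_le power_le_one)
    ultimately show ?thesis using B C by (simp add: R_def \<rho>_def P_def)
  qed
  let ?D = "\<lambda>l h. total_diff W (replicate l h) y"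
  have 1: "norm (W (y + h) - (\<Sum>l<Suc q. (1 / fact l) *\<^sub>R ?D l h)) \<le> B ^ Suc q * \<rho> ^ Suc (Suc q)"
  proof -
    have "norm (W (y + h) - (\<Sum>l<Suc q. (1 / fact l) *\<^sub>R ?D l h)) \<le> C_norm (Suc q) W * norm h ^ Suc q"
      by (rule Taylor_total_diff[OF W]) simp
    also have "\<dots> \<le> \<rho> * (B * \<rho>) ^ Suc q"
      using C_norm_mono[OF W, of "Suc q" n] q B \<rho> unfolding \<rho>_def
      by (intro mult_mono power_mono) auto
    finally show ?thesis by (simp add: power_mult_distrib mult_ac)
  qed
  have 2: "norm ((\<Sum>l<Suc q. (1 / fact l) *\<^sub>R ?D l h) - (\<Sum>l<Suc q. (1 / fact l) *\<^sub>R ?D l P)) \<le>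
      (\<Sum>l<Suc q. l * C * R ^ l) * \<rho> ^ Suc (Suc q)"
    unfolding sum_subtractf[symmetric] sum_distrib_right
  proof (rule sum_norm_le)
    fix l assume l: "l \<in> {..<Suc q}"
    have "norm (?D l h - ?D l P) \<le> \<rho> * prod_list (map norm []) * (l * (C * \<rho> ^ Suc q) * R ^ l)"
      using multilinear_replicate_diff_le[OF multilinear_total_diff[OF W, of y],
          where us = "[]" and l = l and K = \<rho> and h = h and R = R and p = P and \<delta> = "C * \<rho> ^ Suc q"]
        norm_total_diff_le[OF W, of _ n] hR PR B C q l \<rho> by (auto simp: R_def \<rho>_def P_def)
    then have "norm (?D l h - ?D l P) \<le> l * C * R ^ l * \<rho> ^ Suc (Suc q)"
      by (simp add: mult_ac)
    moreover have "norm ((1 / fact l) *\<^sub>R ?D l h - (1 / fact l) *\<^sub>R ?D l P) =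
        (1 / fact l) * norm (?D l h - ?D l P)"
      by (simp add: scaleR_diff_right[symmetric])
    moreover have "\<dots> \<le> 1 * norm (?D l h - ?D l P)"
      by (intro mult_right_mono) (auto simp: divide_le_eq fact_ge_1)
    ultimately show "norm ((1 / fact l) *\<^sub>R ?D l h - (1 / fact l) *\<^sub>R ?D l P) \<le> l * C * R ^ l * \<rho> ^ Suc (Suc q)"
      by linarith
  qed
  (* Expanding by multilinearity produces one tree per list of branches. *)
  have 3: "(\<Sum>l<Suc q. (1 / fact l) *\<^sub>R ?D l P) = (\<Sum>ts\<in>L. summand (ONode ts))"
  proof -
    let ?Ll = "\<lambda>l. {ts. set ts \<subseteq> otrees q \<and> length ts = l}"
    have "(1 / fact l) *\<^sub>R ?D l P = (\<Sum>ts\<in>?Ll l. summand (ONode ts))" for l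
    proof -
      have "prod_list (map (\<lambda>t. oweight t * z (oshape t)) ts) =
          prod_list (map oweight ts) * prod_list (map (\<lambda>t. z (oshape t)) ts)" for ts
        by (induction ts) auto
      moreover have "branches z (oshape (ONode ts)) = prod_list (map (\<lambda>t. z (oshape t)) ts)" for ts
        by (simp add: multiset.map_comp comp_def flip: prod_mset_prod_list)
      ultimately show ?thesis
        unfolding P_def bseries_def
        using multilinear_sum_expand[OF multilinear_total_diff[OF W, of y] finite_otrees, of "[]" l]
        by (auto simp: scaleR_sum_right summand_def intro!: sum.cong simp del: oshape.simps branches.simps)
    qed
    then have "(\<Sum>l<Suc q. (1 / fact l) *\<^sub>R ?D l P) = (\<Sum>l<Suc q. \<Sum>ts\<in>?Ll l. summand (ONode ts))"
      by simp
    also have "\<dots> = (\<Sum>ts\<in>(\<Union>l<Suc q. ?Ll l). summand (ONode ts))"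
      by (rule sum.UNION_disjoint[symmetric]) (auto intro: finite_lists_length_eq)
    also have "(\<Union>l<Suc q. ?Ll l) = L" by (auto simp: L_def)
    finally show ?thesis .
  qed
  define L1 where "L1 = {ts. sum_list (map oorder ts) \<le> q}"
  have L1: "L1 \<subseteq> L"
    using length_le_sum_oorder oorder_le_sum
    by (auto simp: L_def L1_def otrees_def intro: order_trans)
  (* All trees up to order q + 1 have occurred; the others have order at least q + 2, and since \<rho> is at
     most 1 each of them is small enough. *)
  have 4: "norm ((\<Sum>ts\<in>L. summand (ONode ts)) - bseries (Suc q) (branches z) W y) \<le>
      card L * Z ^ q * \<rho> ^ Suc (Suc q)"
  proof -
    have "bseries (Suc q) (branches z) W y = (\<Sum>ts\<in>L1. summand (ONode ts))"
      unfolding bseries_def otrees_Suc L1_def[symmetric] summand_def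
      by (subst sum.reindex) (auto simp: inj_on_def)
    then have "(\<Sum>ts\<in>L. summand (ONode ts)) - bseries (Suc q) (branches z) W y =
        (\<Sum>ts\<in>L - L1. summand (ONode ts))"
      using sum_diff[OF finL L1, of "\<lambda>ts. summand (ONode ts)"] by simp
    also have "norm \<dots> \<le> (\<Sum>ts\<in>L - L1. Z ^ q * \<rho> ^ Suc (Suc q))"
    proof (rule sum_norm_le)
      fix ts assume ts: "ts \<in> L - L1"
      then have tsL: "\<And>t. t \<in> set ts \<Longrightarrow> oorder t \<le> q" "length ts \<le> q"
        and big: "Suc q \<le> sum_list (map oorder ts)"
        by (auto simp: L_def L1_def otrees_def)
      have "prod_list (map norm (map (elem_diff W y) ts)) \<le> \<rho> ^ sum_list (map oorder ts)"
        using tsL(1) q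
      proof (induction ts)
        case (Cons t ts)
        have "norm (elem_diff W y t) \<le> \<rho> ^ oorder t"
          unfolding \<rho>_def using Cons.prems(1)[of t] q by (intro norm_elem_diff_le[OF W]) simp
        then show ?case using Cons \<rho> by (auto simp: power_add intro!: mult_mono prod_list_nonneg zero_le_power)
      qed simp
      also have "\<dots> \<le> \<rho> ^ Suc q" by (rule power_decreasing[OF big]) (use \<rho> in auto)
      finally have "\<rho> * prod_list (map norm (map (elem_diff W y) ts)) \<le> \<rho> * \<rho> ^ Suc q"
        using \<rho> by (intro mult_left_mono) auto
      moreover have "norm (elem_diff W y (ONode ts)) \<le> \<rho> * prod_list (map norm (map (elem_diff W y) ts))"
        unfolding \<rho>_def elem_diff.simps by (rule norm_total_diff_le[OF W]) (use tsL(2) q in simp)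
      ultimately have e: "norm (elem_diff W y (ONode ts)) \<le> \<rho> ^ Suc (Suc q)" by simp
      have "\<bar>prod_list (map (\<lambda>t. z (oshape t)) ts)\<bar> \<le> Z ^ length ts"
        using tsL(1)
      proof (induction ts)
        case (Cons t ts)
        then show ?case using Z by (auto simp: abs_mult intro!: mult_mono)
      qed simp
      also have "\<dots> \<le> Z ^ q" using tsL(2) Z by (intro power_increasing)
      finally have "\<bar>branches z (oshape (ONode ts))\<bar> \<le> Z ^ q"
        by (simp add: multiset.map_comp comp_def flip: prod_mset_prod_list)
      then have "\<bar>oweight (ONode ts) * branches z (oshape (ONode ts))\<bar> \<le> 1 * Z ^ q"
        unfolding abs_mult using oweight_bounds[of "ONode ts"]
        by (intro mult_mono) (auto simp del: oweight.simps oshape.simps)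
      then show "norm (summand (ONode ts)) \<le> Z ^ q * \<rho> ^ Suc (Suc q)"
        unfolding summand_def norm_scaleR using e Z by (intro mult_mono) auto
    qed
    also have "\<dots> \<le> card L * (Z ^ q * \<rho> ^ Suc (Suc q))"
    proof -
      have "card (L - L1) \<le> card L" using finL by (intro card_mono) auto
      then show ?thesis using Z \<rho> by (auto intro!: mult_right_mono)
    qed
    finally show ?thesis by (simp add: mult_ac)
  qed
  have "norm (W (y + h) - bseries (Suc q) (branches z) W y) \<le>
      norm (W (y + h) - (\<Sum>l<Suc q. (1 / fact l) *\<^sub>R ?D l h)) +
      norm ((\<Sum>l<Suc q. (1 / fact l) *\<^sub>R ?D l h) - (\<Sum>l<Suc q. (1 / fact l) *\<^sub>R ?D l P)) +
      norm ((\<Sum>l<Suc q. (1 / fact l) *\<^sub>R ?D l P) - bseries (Suc q) (branches z) W y)"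
    by norm
  also have "\<dots> \<le> B ^ Suc q * \<rho> ^ Suc (Suc q) + (\<Sum>l<Suc q. l * C * R ^ l) * \<rho> ^ Suc (Suc q) +
      card L * Z ^ q * \<rho> ^ Suc (Suc q)"
    using 1 2 4 unfolding 3 by (intro add_mono)
  finally show ?thesis
    unfolding R_def L_def \<rho>_def by (simp only: distrib_right)
qed

section \<open>Series of the method and of the flow\<close>

lemma bseries_sum:
  "bseries q (\<lambda>t. \<Sum>j\<in>J. a j * z j t) W y = (\<Sum>j\<in>J. a j *\<^sub>R bseries q (z j) W y)"
proof -
  have "bseries q (\<lambda>t. \<Sum>j\<in>J. a j * z j t) W y =
      (\<Sum>t\<in>otrees q. \<Sum>j\<in>J. (a j * (oweight t * z j (oshape t))) *\<^sub>R elem_diff W y t)"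
    by (simp add: bseries_def sum_distrib_left scaleR_sum_left mult.left_commute)
  also have "\<dots> = (\<Sum>j\<in>J. \<Sum>t\<in>otrees q. (a j * (oweight t * z j (oshape t))) *\<^sub>R elem_diff W y t)"
    by (rule sum.swap)
  finally show ?thesis by (simp add: bseries_def scaleR_sum_right)
qed

lemma bseries_cong:
  "(\<And>t. tree_order t \<le> q \<Longrightarrow> z t = z' t) \<Longrightarrow> bseries q z W y = bseries q z' W y"
  unfolding bseries_def by (intro sum.cong) (auto simp: otrees_def)

text \<open>
  The stage equation at the level of coefficients.
\<close>

lemma zeta_eq_branches: "zeta A i t = (\<Sum>j\<in>UNIV. A $ i $ j * branches (zeta A j) t)"
  by (cases t) simp

lemma finite_trees_of_bounded_order: "finite {t. tree_order t \<le> q}"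
proof (rule finite_subset)
  have "\<exists>s. oshape s = t" for t
  proof (induction t)
    case (Node M)
    then obtain f where f: "\<And>t. t \<in># M \<Longrightarrow> oshape (f t) = t" by metis
    obtain ts where ts: "M = mset ts" by (metis ex_mset)
    have "map oshape (map f ts) = ts" using f ts by (simp add: map_idI)
    then have "oshape (ONode (map f ts)) = Node M" using ts by (metis oshape.simps)
    then show ?case by blast
  qed
  then show "{t. tree_order t \<le> q} \<subseteq> oshape ` otrees q"
    unfolding otrees_def by (auto simp: image_iff) metis
qed simp

lemma rk_stages_diff:
  assumes "rk_stages A W y 1 Y"
  shows "Y i - y = (\<Sum>j\<in>UNIV. A $ i $ j *\<^sub>R W (Y j))"
proof -
  have "Y i = y + 1 *\<^sub>R (\<Sum>j\<in>UNIV. A $ i $ j *\<^sub>R W (Y j))"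
    using assms unfolding rk_stages_def by (rule spec)
  then have "Y i - y = y + 1 *\<^sub>R (\<Sum>j\<in>UNIV. A $ i $ j *\<^sub>R W (Y j)) - y"
    by (rule arg_cong)
  then show ?thesis by (simp only: scaleR_one add_diff_cancel_left')
qed

lemma rk_combination_expansion:
  fixes c :: "'k::finite \<Rightarrow> real"
  assumes "\<And>j. norm (W (Y j) - bseries q (z j) W y) \<le> \<epsilon>"
  shows "norm ((\<Sum>j\<in>UNIV. c j *\<^sub>R W (Y j)) - bseries q (\<lambda>t. \<Sum>j\<in>UNIV. c j * z j t) W y) \<le>
    (\<Sum>j\<in>UNIV. \<bar>c j\<bar>) * \<epsilon>"
proof -
  have "(\<Sum>j\<in>UNIV. c j *\<^sub>R W (Y j)) - bseries q (\<lambda>t. \<Sum>j\<in>UNIV. c j * z j t) W y =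
      (\<Sum>j\<in>UNIV. c j *\<^sub>R (W (Y j) - bseries q (z j) W y))"
    unfolding bseries_sum by (simp add: sum_subtractf scaleR_diff_right)
  also have "norm \<dots> \<le> (\<Sum>j\<in>UNIV. \<bar>c j\<bar> * \<epsilon>)"
    by (rule sum_norm_le) (simp only: norm_scaleR, rule mult_left_mono[OF assms abs_ge_zero])
  finally show ?thesis by (simp only: sum_distrib_right)
qed

text \<open>
  By induction on \<open>q\<close>.  If the values of \<open>W\<close> at the stages are known up to order \<open>q\<close>, then the stages, which
  are linear combinations of them, are known with the same accuracy, and composing with \<open>W\<close> gains one order.
  Only the stage equations enter, so the bound holds for each of their solutions.
\<close>

lemma rk_field_expansion:
  fixes A :: "real ^ 'k ^ 'k"
  shows "q \<le> n \<Longrightarrow> \<exists>C\<ge>0. \<forall>(W :: real ^ 'n \<Rightarrow> real ^ 'n)\<in>Cb_inf. C_norm n W \<le> 1 \<longrightarrow>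
    (\<forall>y Y i. rk_stages A W y 1 Y \<longrightarrow>
       norm (W (Y i) - bseries q (branches (zeta A i)) W y) \<le> C * C_norm n W ^ Suc q)"
proof (induction q)
  case 0
  show ?case by (rule exI[of _ 1]) (auto simp: bseries_def norm_le_C_norm)
next
  case (Suc q)
  then obtain C where C: "C \<ge> 0"
    "\<And>W :: real ^ 'n \<Rightarrow> real ^ 'n. \<And>y Y i. W \<in> Cb_inf \<Longrightarrow> C_norm n W \<le> 1 \<Longrightarrow> rk_stages A W y 1 Y \<Longrightarrow>
       norm (W (Y i) - bseries q (branches (zeta A i)) W y) \<le> C * C_norm n W ^ Suc q"
    by (meson Suc_leD)
  define a where "a = (\<Sum>i\<in>UNIV. \<Sum>j\<in>UNIV. \<bar>A $ i $ j\<bar>)"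
  have a: "0 \<le> a" unfolding a_def by (intro sum_nonneg) auto
  have row: "(\<Sum>j\<in>UNIV. \<bar>A $ i $ j\<bar>) \<le> a" for i
    unfolding a_def by (rule member_le_sum[of i UNIV]) (auto intro: sum_nonneg)
  define Z where "Z = 1 + (\<Sum>i\<in>UNIV. \<Sum>t | tree_order t \<le> q. \<bar>zeta A i t\<bar>)"
  have Z: "1 \<le> Z" unfolding Z_def by (auto intro!: sum_nonneg)
  have zZ: "\<bar>zeta A i t\<bar> \<le> Z" if "tree_order t \<le> q" for i t
  proof -
    have "\<bar>zeta A i t\<bar> \<le> (\<Sum>t | tree_order t \<le> q. \<bar>zeta A i t\<bar>)"
      by (rule member_le_sum) (use that finite_trees_of_bounded_order in auto)
    also have "\<dots> \<le> (\<Sum>i\<in>UNIV. \<Sum>t | tree_order t \<le> q. \<bar>zeta A i t\<bar>)"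
      by (rule member_le_sum[of i UNIV "\<lambda>i. \<Sum>t | tree_order t \<le> q. \<bar>zeta A i t\<bar>"])
        (auto intro: sum_nonneg)
    finally show ?thesis unfolding Z_def by linarith
  qed
  define C' where "C' = a ^ Suc q + (\<Sum>l<Suc q. l * (a * C) * (1 + a + a * C) ^ l) +
      card {ts. set ts \<subseteq> otrees q \<and> length ts \<le> q} * Z ^ q"
  have C': "0 \<le> C'" unfolding C'_def using a C(1) Z by (intro add_nonneg_nonneg sum_nonneg) auto
  have "norm (W (Y i) - bseries (Suc q) (branches (zeta A i)) W y) \<le> C' * C_norm n W ^ Suc (Suc q)"
    if W: "W \<in> Cb_inf" "C_norm n W \<le> 1" and Y: "rk_stages A W y 1 Y"
    for W :: "real ^ 'n \<Rightarrow> real ^ 'n" and y Y i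
  proof -
    have \<rho>: "0 \<le> C_norm n W" by (rule C_norm_nonneg[OF W(1)])
    have "norm (Y i - y) \<le> (\<Sum>j\<in>UNIV. \<bar>A $ i $ j\<bar> * C_norm n W)"
      unfolding rk_stages_diff[OF Y]
      by (rule sum_norm_le) (auto intro!: mult_left_mono norm_le_C_norm[OF W(1)])
    also have "\<dots> = (\<Sum>j\<in>UNIV. \<bar>A $ i $ j\<bar>) * C_norm n W"
      by (simp only: sum_distrib_right)
    also have "\<dots> \<le> a * C_norm n W"
      by (rule mult_right_mono[OF row \<rho>])
    finally have 1: "norm (Y i - y) \<le> a * C_norm n W" .
    have "zeta A i = (\<lambda>t. \<Sum>j\<in>UNIV. A $ i $ j * branches (zeta A j) t)"
      by (rule ext) (rule zeta_eq_branches)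
    then have "norm (Y i - y - bseries q (zeta A i) W y) \<le>
        (\<Sum>j\<in>UNIV. \<bar>A $ i $ j\<bar>) * (C * C_norm n W ^ Suc q)"
      using rk_combination_expansion[of W Y q "\<lambda>j. branches (zeta A j)" y _ "\<lambda>j. A $ i $ j", OF C(2)[OF W Y]]
      unfolding rk_stages_diff[OF Y] by simp
    also have "\<dots> \<le> a * (C * C_norm n W ^ Suc q)"
      using C(1) \<rho> by (intro mult_right_mono[OF row]) auto
    finally have 2: "norm (Y i - y - bseries q (zeta A i) W y) \<le> (a * C) * C_norm n W ^ Suc q"
      by (simp only: mult.assoc)
    show ?thesis
      using bseries_compose[OF W(1) _ W(2) a 1 _ 2 Z zZ] Suc.prems a C(1)
      by (simp add: C'_def del: power_Suc sum.lessThan_Suc)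
  qed
  then show ?case using C' by (intro exI[of _ C']) blast
qed

text \<open>
  The coefficients of the exact solution at time \<open>s\<close>.
\<close>

definition flow_coeff :: "real \<Rightarrow> rtree \<Rightarrow> real" where
  "flow_coeff s t = s ^ tree_order t / tree_density t"

text \<open>
  The right-hand side is the derivative of the coefficient with respect to \<open>s\<close>.  So this is the
  differential equation of the flow at the level of coefficients.
\<close>

lemma branches_flow_coeff:
  "branches (flow_coeff s) t = s ^ (tree_order t - 1) * tree_order t / tree_density t"
proof (cases t)
  case (Node M)
  have "\<Prod>\<^sub># (image_mset (flow_coeff s) M) =
      s ^ \<Sum>\<^sub># (image_mset tree_order M) / real (\<Prod>\<^sub># (image_mset tree_density M))"
    by (induction M) (auto simp: flow_coeff_def power_add)
  moreover have "real (tree_density t) = tree_order t * real (\<Prod>\<^sub># (image_mset tree_density M))"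
    using Node by (simp add: algebra_simps)
  moreover have "tree_order t - 1 = \<Sum>\<^sub># (image_mset tree_order M)"
    using Node by simp
  moreover have "real (tree_order t) > 0" using tree_order_pos by (rule of_nat_0_less_iff[THEN iffD2])
  ultimately show ?thesis using Node by simp
qed

lemma bseries_flow_coeff_derivative:
  "((\<lambda>s. bseries q (flow_coeff s) W y) has_vector_derivative
     bseries q (branches (flow_coeff s)) W y) (at s within S)"
  unfolding bseries_def
proof (rule has_vector_derivative_sum)
  fix t
  have "((\<lambda>s. oweight t * flow_coeff s (oshape t)) has_real_derivative
      oweight t * branches (flow_coeff s) (oshape t)) (at s within S)"
    unfolding branches_flow_coeff flow_coeff_def
    by (auto intro!: derivative_eq_intros simp: less_imp_neq[OF tree_density_pos, symmetric])
  then show "((\<lambda>s. (oweight t * flow_coeff s (oshape t)) *\<^sub>R elem_diff W y t) has_vector_derivative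
      (oweight t * branches (flow_coeff s) (oshape t)) *\<^sub>R elem_diff W y t) (at s within S)"
    unfolding has_real_derivative_iff_has_vector_derivative
    by (rule bounded_linear.has_vector_derivative[OF bounded_linear_scaleR_left])
qed

lemma bseries_flow_coeff_0: "bseries q (flow_coeff 0) W y = 0"
  unfolding bseries_def flow_coeff_def by (simp add: zero_power)

text \<open>
  The mean value inequality for the difference between the solution and the series, which vanishes at
  time \<open>0\<close> and whose derivative is the difference in the hypothesis.
\<close>

lemma flow_line_expansion:
  assumes z: "flow_line W z" "z 0 = y" and s: "s \<in> {0..1}"
    and \<epsilon>: "\<And>s. s \<in> {0..1} \<Longrightarrow> norm (W (z s) - bseries q (branches (flow_coeff s)) W y) \<le> \<epsilon>"
  shows "norm (z s - y - bseries q (flow_coeff s) W y) \<le> \<epsilon>"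
proof -
  define e where "e s = z s - y - bseries q (flow_coeff s) W y" for s
  define e' where "e' s = W (z s) - bseries q (branches (flow_coeff s)) W y" for s
  have D: "(e has_vector_derivative e' s) (at s within {0..1})" if "s \<in> {0..1}" for s
    unfolding e_def[abs_def] e'_def
    using z(1) that
    by (auto simp: flow_line_def intro!: derivative_eq_intros bseries_flow_coeff_derivative)
  have "norm (e s - e 0) \<le> \<epsilon> * norm (s - 0)"
  proof (rule differentiable_bound[of "{0..1}" e "\<lambda>s h. h *\<^sub>R e' s"])
    show "onorm (\<lambda>h. h *\<^sub>R e' s) \<le> \<epsilon>" if "s \<in> {0..1}" for s
      by (rule onorm_le) (use \<epsilon>[OF that] in \<open>simp add: e'_def mult.commute[of \<epsilon>] mult_left_mono\<close>)
  qed (use D s in \<open>auto simp: has_vector_derivative_def\<close>)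
  moreover have "\<epsilon> * norm (s - 0) \<le> \<epsilon>"
    using s order_trans[OF norm_ge_zero \<epsilon>[OF s]] by (simp add: mult_left_le)
  ultimately show ?thesis by (simp add: e_def z(2) bseries_flow_coeff_0)
qed

text \<open>
  The same induction as for the stages, with integration in time in place of the linear combination.
\<close>

lemma flow_field_expansion:
  "q \<le> n \<Longrightarrow> \<exists>C\<ge>0. \<forall>(W :: real ^ 'n \<Rightarrow> real ^ 'n)\<in>Cb_inf. C_norm n W \<le> 1 \<longrightarrow>
    (\<forall>z. flow_line W z \<longrightarrow> (\<forall>s\<in>{0..1}.
       norm (W (z s) - bseries q (branches (flow_coeff s)) W (z 0)) \<le> C * C_norm n W ^ Suc q))"
proof (induction q)
  case 0
  show ?case by (rule exI[of _ 1]) (auto simp: bseries_def norm_le_C_norm)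
next
  case (Suc q)
  then obtain C where C: "C \<ge> 0"
    "\<And>W :: real ^ 'n \<Rightarrow> real ^ 'n. \<And>z s. W \<in> Cb_inf \<Longrightarrow> C_norm n W \<le> 1 \<Longrightarrow> flow_line W z \<Longrightarrow> s \<in> {0..1} \<Longrightarrow>
       norm (W (z s) - bseries q (branches (flow_coeff s)) W (z 0)) \<le> C * C_norm n W ^ Suc q"
    by (meson Suc_leD)
  have zZ: "\<bar>flow_coeff s t\<bar> \<le> 1" if "s \<in> {0..1}" for s t
  proof -
    have "s ^ tree_order t \<le> 1" using that by (intro power_le_one) auto
    moreover have "1 \<le> real (tree_density t)" using tree_density_pos[of t] by linarith
    ultimately show ?thesis using that by (simp add: flow_coeff_def divide_le_eq)
  qed
  define C' where "C' = 1 ^ Suc q + (\<Sum>l<Suc q. l * C * (1 + 1 + C) ^ l) +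
      card {ts. set ts \<subseteq> otrees q \<and> length ts \<le> q} * 1 ^ q"
  have C': "0 \<le> C'" unfolding C'_def using C(1) by (intro add_nonneg_nonneg sum_nonneg) auto
  have "norm (W (z s) - bseries (Suc q) (branches (flow_coeff s)) W (z 0)) \<le> C' * C_norm n W ^ Suc (Suc q)"
    if W: "W \<in> Cb_inf" "C_norm n W \<le> 1" and z: "flow_line W z" and s: "s \<in> {0..1}"
    for W :: "real ^ 'n \<Rightarrow> real ^ 'n" and z s
  proof -
    have 1: "norm (z s - z 0) \<le> 1 * C_norm n W"
      using flow_line_expansion[OF z refl s, of 0 "C_norm n W"] norm_le_C_norm[OF W(1)]
      by (simp add: bseries_def)
    have 2: "norm (z s - z 0 - bseries q (flow_coeff s) W (z 0)) \<le> C * C_norm n W ^ Suc q"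
      by (rule flow_line_expansion[OF z refl s C(2)[OF W z]])
    show ?thesis
      using bseries_compose[OF W(1) _ W(2) _ 1 C(1) 2 order_refl zZ[OF s]] Suc.prems
      by (simp add: C'_def del: power_Suc sum.lessThan_Suc)
  qed
  then show ?case using C' by (intro exI[of _ C']) blast
qed

text \<open>
  By the count of labelled trees, \<open>\<alpha>(t) / r(t)! = 1 / (\<sigma>(t) \<gamma>(t))\<close>; the factor \<open>\<sigma>(t)\<close> cancels from
  the order condition.
\<close>

lemma order_conditions_branches:
  assumes "order_conditions m A b" "tree_order t \<le> m"
  shows "(\<Sum>i\<in>UNIV. b $ i * branches (zeta A i) t) = flow_coeff 1 t"
proof -
  obtain M where t: "t = Node M" by (cases t)
  have "real (tree_alpha t) / fact (tree_order t) =
      (\<Sum>i\<in>UNIV. b $ i * branches (zeta A i) t) / tree_sigma t"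
    using assms t unfolding order_conditions_def by simp
  moreover have "real (tree_alpha t) * tree_sigma t * tree_density t = fact (tree_order t)"
    using tree_alpha_formula[of t] by (metis of_nat_fact of_nat_mult)
  moreover have "tree_sigma t > 0" "tree_density t > 0" by (rule tree_sigma_pos tree_density_pos)+
  ultimately show ?thesis
    by (simp add: flow_coeff_def field_simps del: tree_sigma_pos tree_density_pos)
qed

theorem theorem4p15:
  fixes A :: "real ^ 'k ^ 'k" and b :: "real ^ 'k" and m :: nat
    and g :: "(real ^ 'n \<Rightarrow> real ^ 'n) \<Rightarrow> real ^ 'n \<Rightarrow> real ^ 'n"
  assumes "m \<ge> 1"
    and "order_conditions m A b"
    and "\<And>W y0. W \<in> Cb_inf \<Longrightarrow> rk_step A b W y0 1 (g W y0)"
  shows "g \<in> IS m"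
proof -
  let ?n = "m + 1"
  define \<beta> where "\<beta> = (\<Sum>i\<in>UNIV. \<bar>b $ i\<bar>)"
  have \<beta>: "0 \<le> \<beta>" unfolding \<beta>_def by (intro sum_nonneg) auto
  obtain C where C: "C \<ge> 0"
    "\<And>W :: real ^ 'n \<Rightarrow> real ^ 'n. \<And>y Y i. W \<in> Cb_inf \<Longrightarrow> C_norm ?n W \<le> 1 \<Longrightarrow> rk_stages A W y 1 Y \<Longrightarrow>
       norm (W (Y i) - bseries m (branches (zeta A i)) W y) \<le> C * C_norm ?n W ^ Suc m"
    using rk_field_expansion[of m ?n A] by (metis le_add1)
  obtain C' where C': "C' \<ge> 0"
    "\<And>W :: real ^ 'n \<Rightarrow> real ^ 'n. \<And>z s. W \<in> Cb_inf \<Longrightarrow> C_norm ?n W \<le> 1 \<Longrightarrow> flow_line W z \<Longrightarrow> s \<in> {0..1} \<Longrightarrow>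
       norm (W (z s) - bseries m (branches (flow_coeff s)) W (z 0)) \<le> C' * C_norm ?n W ^ Suc m"
    using flow_field_expansion[of m ?n] by (metis le_add1)
  define K where "K = \<beta> * C + C' + \<beta> + 1"
  have "norm (g W x - exp_flow W x) \<le> K * C_norm ?n W ^ ?n" if W: "W \<in> Cb_inf" for W x
  proof -
    define \<rho> where "\<rho> = C_norm ?n W"
    have \<rho>: "0 \<le> \<rho>" unfolding \<rho>_def by (rule C_norm_nonneg[OF W])
    obtain Y where Y: "rk_stages A W x 1 Y" and "g W x = x + 1 *\<^sub>R (\<Sum>i\<in>UNIV. b $ i *\<^sub>R W (Y i))"
      using assms(3)[OF W, of x] unfolding rk_step_def by blast
    then have g: "g W x - x = (\<Sum>i\<in>UNIV. b $ i *\<^sub>R W (Y i))" by simp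
    obtain z where z: "flow_line W z" "z 0 = x" "exp_flow W x = z 1"
      using exp_flow_flow_line[OF W] by blast
    have tri: "norm (g W x - exp_flow W x) \<le> u + v"
      if "norm (g W x - x - p) \<le> u" "norm (z 1 - x - p) \<le> v" for p u v
    proof -
      have eq: "g W x - exp_flow W x = (g W x - x - p) - (z 1 - x - p)" by (simp add: z(3))
      show ?thesis unfolding eq using that norm_triangle_ineq4[of "g W x - x - p" "z 1 - x - p"] by linarith
    qed
    show ?thesis
    proof (cases "\<rho> \<le> 1")
      case True
      have "bseries m (\<lambda>t. \<Sum>i\<in>UNIV. b $ i * branches (zeta A i) t) W x = bseries m (flow_coeff 1) W x"
        by (rule bseries_cong) (rule order_conditions_branches[OF assms(2)])
      then have "norm (g W x - x - bseries m (flow_coeff 1) W x) \<le> \<beta> * (C * \<rho> ^ Suc m)"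
        unfolding g \<beta>_def
        using rk_combination_expansion[where Y = Y and z = "\<lambda>i. branches (zeta A i)" and c = "\<lambda>i. b $ i",
            OF C(2)[OF W True[unfolded \<rho>_def] Y]]
        by (simp add: \<rho>_def)
      moreover have "norm (z 1 - x - bseries m (flow_coeff 1) W x) \<le> C' * \<rho> ^ Suc m"
        using flow_line_expansion[OF z(1,2), of 1 m] C'(2)[OF W True[unfolded \<rho>_def] z(1)] z(2)
        by (simp add: \<rho>_def)
      ultimately have "norm (g W x - exp_flow W x) \<le> \<beta> * (C * \<rho> ^ Suc m) + C' * \<rho> ^ Suc m"
        by (rule tri)
      also have "\<dots> = (\<beta> * C + C') * \<rho> ^ ?n" by (simp add: algebra_simps)
      also have "\<dots> \<le> K * \<rho> ^ ?n"
        unfolding K_def using \<beta> \<rho> by (intro mult_right_mono) auto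
      finally show ?thesis by (simp only: \<rho>_def)
    next
      case False
      (* Both steps have length at most a multiple of \<rho>, which is below its power m + 1. *)
      have field: "norm (W v) \<le> \<rho>" for v unfolding \<rho>_def by (rule norm_le_C_norm[OF W])
      have "norm (g W x - x) \<le> (\<Sum>i\<in>UNIV. \<bar>b $ i\<bar> * \<rho>)"
        unfolding g by (rule sum_norm_le) (auto intro!: mult_left_mono field)
      then have "norm (g W x - x - 0) \<le> \<beta> * \<rho>" by (simp add: \<beta>_def sum_distrib_right)
      moreover have "norm (z 1 - x - 0) \<le> \<rho>"
        using flow_line_expansion[OF z(1,2), of 1 0 \<rho>] field by (simp add: bseries_def)
      ultimately have "norm (g W x - exp_flow W x) \<le> \<beta> * \<rho> + \<rho>" by (rule tri)
      also have "\<dots> = (\<beta> + 1) * \<rho> ^ 1" by (simp add: algebra_simps)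
      also have "\<dots> \<le> K * \<rho> ^ ?n"
        unfolding K_def using False \<beta> C(1) C'(1) \<rho> by (intro mult_mono power_increasing) auto
      finally show ?thesis by (simp only: \<rho>_def)
    qed
  qed
  moreover have "K > 0" unfolding K_def using \<beta> C(1) C'(1) by (simp add: add_nonneg_pos)
  ultimately show ?thesis unfolding IS_def by blast
qed

end
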